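(* Let $X$ be a real uniformly convex Banach space satisfying the Opial condition and $K$ a nonempty closed convex subset of $X$. Let $E:X\to X$ be the identity mapping. Let $N\ge 1$, let $T_1,\dots,T_N:K\to K$ and $I_1,\dots,I_N:K\to K$ be mappings such that: each $T_j$ is uniformly $L_1$-Lipschitzian and asymptotically quasi $I_j$-nonexpansive with a common (independent of $j$) sequence $\{\lambda_n\}\subset[1,\infty)$; each $I_j$ is uniformly $L_2$-Lipschitzian and asymptotically quasi-nonexpansive with a common sequence $\{\mu_n\}\subset[1,\infty)$; and $F=\bigcap_{j=1}^N\left(F(T_j)\cap F(I_j)\right)\neq\emptyset$. Put $B_{*}=\inf_n\beta_n$, $B^{*}=\sup_n\beta_n$, $\Lambda=\sup_n\lambda_n\ge 1$, $M=\sup_n\mu_n\ge 1$, and suppose that $\{\alpha_n\},\{\beta_n\},\{\gamma_n\},\{\widehat{\alpha}_n\},\{\widehat{\beta}_n\},\{\widehat{\gamma}_n\}$ are six sequences in $[0,1]$ satisfying: (i) $\alpha_n+\beta_n+\gamma_n=\widehat{\alpha}_n+\widehat{\beta}_n+\widehat{\gamma}_n=1$ for all $n\ge 1$; (ii) $\sum_{n=1}^{\infty}(\lambda_n\mu_n-1)\beta_n<\infty$; (iii) $0<B_{*}\le B^{*}<\dfrac{1}{\Lambda^2M^2}<1$; (iv) $0<\widehat B_{*}=\inf_n\widehat\beta_n\le\sup_n\widehat\beta_n=\widehat B^{*}<1$; (v) $\sum_{n=1}^\infty\gamma_n<\infty$ and $\sum_{n=1}^\infty\widehat{\gamma}_n<\infty$.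 Let $\{u_n\},\{v_n\}$ be bounded sequences in $K$ and let $\{x_n\}\subset K$ be the implicit iterative sequence with errors given by $x_0\in K$ and, for $n\ge 1$, $$x_n=\alpha_n x_{n-1}+\beta_n T_{j(n)}^{k(n)}y_n+\gamma_n u_n,\qquad y_n=\widehat{\alpha}_n x_n+\widehat{\beta}_n I_{j(n)}^{k(n)}x_n+\widehat{\gamma}_n v_n .$$ If the mappings $E-T_j$ and $E-I_j$ are semi-closed at zero for every $j=1,\dots,N$, then $\{x_n\}$ converges weakly to a common fixed point of $\{T_j\}_{j=1}^N$ and $\{I_j\}_{j=1}^N$ (i.e. to a point of $F$).
   Context: For a mapping $T:K\to K$, $F(T)=\{x\in K: Tx=x\}$ is its set of fixed points, and $T^n$ is the $n$-th iterate. $I:K\to K$ is asymptotically quasi-nonexpansive with sequence $\{\mu_n\}\subset[1,\infty)$ if $\lim_{n\to\infty}\mu_n=1$ and $\|I^nx-p\|\le\mu_n\|x-p\|$ for all $x\in K$, $p\in F(I)$, $n\ge 1$. For $T,I:K\to K$, $T$ is asymptotically quasi $I$-nonexpansive with sequence $\{\lambda_n\}\subset[1,\infty)$ if $\lim_{n\to\infty}\lambda_n=1$ and $\|T^nx-p\|\le\lambda_n\|I^nx-p\|$ for all $x\in K$, $p\in F(T)\cap F(I)$, $n\ge 1$. $T:K\to K$ is uniformly $L$-Lipschitzian ($L>0$ a constant) if $\|T^nx-T^ny\|\le L\|x-y\|$ for all $x,y\in K$, $n\ge 1$. $X$ satisfies the Opial condition if, whenever a sequence $\{x_n\}$ in $X$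 converges weakly to $x$, one has $\liminf_{n\to\infty}\|x_n-x\|<\liminf_{n\to\infty}\|x_n-y\|$ for all $y\in X$ with $y\ne x$. A mapping $S$ from $K$ into $X$ is semi-closed (demi-closed) at zero if for each bounded sequence $\{x_n\}$ in $K$, the conditions that $x_n$ converges weakly to $x\in K$ and $Sx_n$ converges strongly to $0$ imply $Sx=0$. For each integer $n\ge1$, $k(n)\ge 1$ and $j(n)\in\{1,\dots,N\}$ are the unique integers with $n=(k(n)-1)N+j(n)$. The sequence $\{x_n\}$ is understood as a sequence in $K$ satisfying the implicit equations above. *)

theory Defs
  imports "HOL-Analysis.Analysis"
begin

text \<open>Sequences are functions on \<^typ>\<open>nat\<close>. Those that the mathematics indexes by
  \<open>n \<ge> 1\<close> are never constrained at the index \<open>0\<close>.\<close>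

definition uniformly_convex :: "'a::real_normed_vector itself \<Rightarrow> bool" where
  "uniformly_convex (_ :: 'a itself) \<longleftrightarrow>
     (\<forall>\<epsilon>>0. \<exists>\<delta>>0. \<forall>x y :: 'a.
        norm x \<le> 1 \<longrightarrow> norm y \<le> 1 \<longrightarrow> \<epsilon> \<le> norm (x - y) \<longrightarrow>
        norm ((1/2) *\<^sub>R (x + y)) \<le> 1 - \<delta>)"

definition weakly_converges :: "(nat \<Rightarrow> 'a::real_normed_vector) \<Rightarrow> 'a \<Rightarrow> bool" where
  "weakly_converges x l \<longleftrightarrow>
     (\<forall>f :: 'a \<Rightarrow> real. bounded_linear f \<longrightarrow> (\<lambda>n. f (x n)) \<longlonglongrightarrow> f l)"

text \<open>The limit inferior is taken in the extended reals, where it always exists; weakly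
  convergent sequences are bounded, so only finite values occur.\<close>

definition opial_condition :: "'a::real_normed_vector itself \<Rightarrow> bool" where
  "opial_condition (_ :: 'a itself) \<longleftrightarrow>
     (\<forall>(x :: nat \<Rightarrow> 'a) l. weakly_converges x l \<longrightarrow>
        (\<forall>y. y \<noteq> l \<longrightarrow>
           liminf (\<lambda>n. ereal (norm (x n - l))) < liminf (\<lambda>n. ereal (norm (x n - y)))))"

definition fixed_points :: "'a set \<Rightarrow> ('a \<Rightarrow> 'a) \<Rightarrow> 'a set" where
  "fixed_points K T = {x \<in> K. T x = x}"

definition asymptotically_quasi_nonexpansive ::
    "'a::real_normed_vector set \<Rightarrow> ('a \<Rightarrow> 'a) \<Rightarrow> (nat \<Rightarrow> real) \<Rightarrow> bool" where
  "asymptotically_quasi_nonexpansive K I \<mu> \<longleftrightarrow>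
     (\<forall>n\<ge>1. 1 \<le> \<mu> n) \<and> \<mu> \<longlonglongrightarrow> 1 \<and>
     (\<forall>x\<in>K. \<forall>p\<in>fixed_points K I. \<forall>n\<ge>1.
        norm ((I ^^ n) x - p) \<le> \<mu> n * norm (x - p))"

definition asymptotically_quasi_nonexpansive_wrt ::
    "'a::real_normed_vector set \<Rightarrow> ('a \<Rightarrow> 'a) \<Rightarrow> ('a \<Rightarrow> 'a) \<Rightarrow> (nat \<Rightarrow> real) \<Rightarrow> bool" where
  "asymptotically_quasi_nonexpansive_wrt K I T lam \<longleftrightarrow>
     (\<forall>n\<ge>1. 1 \<le> lam n) \<and> lam \<longlonglongrightarrow> 1 \<and>
     (\<forall>x\<in>K. \<forall>p\<in>fixed_points K T \<inter> fixed_points K I. \<forall>n\<ge>1.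
        norm ((T ^^ n) x - p) \<le> lam n * norm ((I ^^ n) x - p))"

definition uniformly_lipschitzian ::
    "'a::real_normed_vector set \<Rightarrow> ('a \<Rightarrow> 'a) \<Rightarrow> real \<Rightarrow> bool" where
  "uniformly_lipschitzian K T L \<longleftrightarrow>
     0 < L \<and> (\<forall>x\<in>K. \<forall>y\<in>K. \<forall>n\<ge>1. norm ((T ^^ n) x - (T ^^ n) y) \<le> L * norm (x - y))"

definition semi_closed_at_zero ::
    "'a::real_normed_vector set \<Rightarrow> ('a \<Rightarrow> 'a) \<Rightarrow> bool" where
  "semi_closed_at_zero K S \<longleftrightarrow>
     (\<forall>(x :: nat \<Rightarrow> 'a) l. range x \<subseteq> K \<longrightarrow> bounded (range x) \<longrightarrow> l \<in> K \<longrightarrow>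
        weakly_converges x l \<longrightarrow> (\<lambda>n. S (x n)) \<longlonglongrightarrow> 0 \<longrightarrow> S l = 0)"

end

theory Submission
  imports Defs
begin

text \<open>For \<open>p \<in> F\<close> the distances \<open>norm (x n - p)\<close> satisfy \<open>a (n + 1) \<le> (1 + b n) * a n + c n\<close> with
  summable \<open>b\<close> and \<open>c\<close>, so they converge. Since \<open>x n\<close> and \<open>y n\<close> are, up to summable errors, convex
  combinations of points whose distances to \<open>p\<close> have the same limit, uniform convexity (in the form
  of Schu's lemma) forces those points together; the Lipschitz conditions turn this into
  \<open>x n - T i (x n) \<longlonglongrightarrow> 0\<close> and \<open>x n - I i (x n) \<longlonglongrightarrow> 0\<close>. By semi-closedness all weak subsequential limits
  lie in \<open>F\<close>, and by the Opial condition there is at most one.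

  That weak subsequential limits exist is proved without the dual space. Among the infinite
  index sets choose \<open>A\<close> such that passing to a subset no longer increases the limit of the minimal norms
  of the convex hulls of the tails. By uniform convexity, almost minimal points of these hulls
  converge to some \<open>l\<close>, which lies in the closed convex hull of \<open>x ` B\<close> for every infinite \<open>B \<subseteq> A\<close>.
  A functional that stays away from its value at \<open>l\<close> along infinitely many indices of \<open>A\<close> would
  separate \<open>l\<close> from such a hull.\<close>

section \<open>Uniform convexity\<close>

text \<open>Dividing by the radius \<open>d + \<eta>\<close> reduces to the unit ball, where two
  distant points have a midpoint of norm at most \<open>1 - \<delta>\<close>. A weight in
  \<open>[c, 1 - c]\<close> gives the midpoint a share of at least \<open>2 * c\<close>, so the
  combination would drop below \<open>d - \<eta>\<close>. For \<open>d = 0\<close> this gain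
  vanishes, but then both points are small.\<close>

lemma uniformly_convex_combination:
  fixes d \<epsilon> c :: real
  assumes uc: "uniformly_convex TYPE('a::real_normed_vector)"
    and "0 \<le> d" "0 < \<epsilon>" "0 < c"
  shows "\<exists>\<eta>>0. \<forall>(a::'a) b t. c \<le> t \<longrightarrow> t \<le> 1 - c \<longrightarrow> norm a \<le> d + \<eta> \<longrightarrow> norm b \<le> d + \<eta> \<longrightarrow>
       d - \<eta> \<le> norm ((1 - t) *\<^sub>R a + t *\<^sub>R b) \<longrightarrow> norm (a - b) < \<epsilon>"
proof (cases "d = 0")
  case True
  show ?thesis
  proof (intro exI[of _ "\<epsilon>/3"] conjI allI impI)
    fix a b :: 'a assume "norm a \<le> d + \<epsilon>/3" "norm b \<le> d + \<epsilon>/3"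
    then show "norm (a - b) < \<epsilon>"
      using norm_triangle_ineq4[of a b] True \<open>0 < \<epsilon>\<close> by simp
  qed (use \<open>0 < \<epsilon>\<close> in simp)
next
  case False
  with \<open>0 \<le> d\<close> have d: "0 < d" by simp
  \<comment> \<open>Bounding the radius by \<open>d + 1\<close> allows \<delta> to be fixed before
    \<eta> is chosen.\<close>
  then have "0 < \<epsilon> / (d + 1)" using \<open>0 < \<epsilon>\<close> by simp
  then obtain \<delta> where \<delta>: "0 < \<delta>"
    "\<And>x y :: 'a. \<lbrakk>norm x \<le> 1; norm y \<le> 1; \<epsilon> / (d + 1) \<le> norm (x - y)\<rbrakk>
       \<Longrightarrow> norm ((1/2) *\<^sub>R (x + y)) \<le> 1 - \<delta>"
    using uc unfolding uniformly_convex_def by blast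
  \<comment> \<open>The cap \<open>1\<close> keeps the radius at most \<open>d + 1\<close>; the
    other term makes the gain \<open>2 * c * \<delta> * d\<close> exceed
    \<open>2 * \<eta>\<close>.\<close>
  define \<eta> where "\<eta> = min 1 (c * \<delta> * d / 2)"
  have \<eta>: "0 < \<eta>" "\<eta> \<le> 1" "\<eta> < c * \<delta> * d"
    using \<open>0 < c\<close> \<delta>(1) d by (auto simp: \<eta>_def min_def)
  show ?thesis
  proof (intro exI[of _ \<eta>] conjI allI impI)
    fix a b :: 'a and t
    assume t: "c \<le> t" "t \<le> 1 - c" and ab: "norm a \<le> d + \<eta>" "norm b \<le> d + \<eta>"
      and low: "d - \<eta> \<le> norm ((1 - t) *\<^sub>R a + t *\<^sub>R b)"
    let ?R = "d + \<eta>"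
    have R: "0 < ?R" "?R \<le> d + 1" using d \<eta> by auto
    show "norm (a - b) < \<epsilon>"
    proof (rule ccontr)
      assume "\<not> norm (a - b) < \<epsilon>"
      then have far: "\<epsilon> \<le> norm (a - b)" by simp
      have "\<epsilon> / (d + 1) \<le> \<epsilon> / ?R"
        using R \<open>0 < \<epsilon>\<close> by (simp add: frac_le)
      also have "\<dots> \<le> norm (a - b) / ?R"
        using far R by (simp add: divide_right_mono)
      also have "\<dots> = norm (a /\<^sub>R ?R - b /\<^sub>R ?R)"
        using R by (simp add: scaleR_diff_right[symmetric] divide_inverse mult.commute)
      finally have "norm ((1/2) *\<^sub>R (a /\<^sub>R ?R + b /\<^sub>R ?R)) \<le> 1 - \<delta>"
        using ab R by (intro \<delta>(2)) (simp_all add: field_simps)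
      moreover have "(1/2) *\<^sub>R (a /\<^sub>R ?R + b /\<^sub>R ?R) = inverse ?R *\<^sub>R ((1/2) *\<^sub>R (a + b))"
        by (simp add: scaleR_add_right mult.commute)
      ultimately have "norm ((1/2) *\<^sub>R (a + b)) / ?R \<le> 1 - \<delta>"
        using R by (metis abs_of_pos divide_inverse inverse_positive_iff_positive mult.commute norm_scaleR)
      then have mid: "norm ((1/2) *\<^sub>R (a + b)) \<le> ?R * (1 - \<delta>)"
        using R by (metis mult.commute pos_divide_le_eq)
      \<comment> \<open>With the smaller weight on \<open>q\<close>, the combination lies between
        \<open>p\<close> and the midpoint; exchanging the points covers
        \<open>t > 1/2\<close>.\<close>
      have aux: "norm ((1 - s) *\<^sub>R p + s *\<^sub>R q) \<le> ?R * (1 - 2 * c * \<delta>)"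
        if "c \<le> s" "s \<le> 1/2" "norm p \<le> ?R" "norm ((1/2) *\<^sub>R (p + q)) \<le> ?R * (1 - \<delta>)"
        for p q :: 'a and s
      proof -
        have "(1 - s) *\<^sub>R p + s *\<^sub>R q = (2 * s) *\<^sub>R ((1/2) *\<^sub>R (p + q)) + (1 - 2 * s) *\<^sub>R p"
          by (simp add: algebra_simps) (simp add: scaleR_add_left[symmetric])
        also have "norm \<dots> \<le> (2 * s) * norm ((1/2) *\<^sub>R (p + q)) + (1 - 2 * s) * norm p"
          using that \<open>0 < c\<close> norm_triangle_ineq[of "(2 * s) *\<^sub>R ((1/2) *\<^sub>R (p + q))" "(1 - 2 * s) *\<^sub>R p"]
          by simp
        also have "\<dots> \<le> (2 * s) * (?R * (1 - \<delta>)) + (1 - 2 * s) * ?R"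
          using that \<open>0 < c\<close> by (intro add_mono mult_left_mono) auto
        also have "\<dots> = ?R - 2 * (s * (\<delta> * ?R))" by (simp add: algebra_simps)
        also have "\<dots> \<le> ?R - 2 * (c * (\<delta> * ?R))"
          using mult_right_mono[OF \<open>c \<le> s\<close>, of "\<delta> * ?R"] \<delta>(1) R by simp
        finally show ?thesis by (simp add: algebra_simps)
      qed
      have "norm ((1 - t) *\<^sub>R a + t *\<^sub>R b) \<le> ?R * (1 - 2 * c * \<delta>)"
      proof (cases "t \<le> 1/2")
        case True then show ?thesis using aux[of t a b] t ab mid by simp
      next
        case False then show ?thesis
          using aux[of "1 - t" b a] t ab mid by (simp add: add.commute)
      qed
      also have "\<dots> = d + \<eta> - 2 * (c * \<delta> * d) - 2 * (c * \<delta> * \<eta>)"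
        by (simp add: algebra_simps)
      also have "\<dots> < d - \<eta>"
        using \<eta> mult_pos_pos[OF mult_pos_pos[OF \<open>0 < c\<close> \<delta>(1)] \<eta>(1)] by linarith
      finally show False using low by simp
    qed
  qed (rule \<eta>(1))
qed

text \<open>Schu's lemma. Only upper bounds tending to \<open>d\<close> are asked of
  \<open>a\<close> and \<open>b\<close>, because the norms of the iterated images are not known
  beforehand to converge.\<close>

lemma uniformly_convex_tendsto_diff:
  fixes a b :: "nat \<Rightarrow> 'a::real_normed_vector"
  assumes uc: "uniformly_convex TYPE('a)"
    and "0 < c" and t: "\<forall>\<^sub>F n in sequentially. c \<le> t n \<and> t n \<le> 1 - c"
    and a: "\<forall>\<^sub>F n in sequentially. norm (a n) \<le> A n" "A \<longlonglongrightarrow> d"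
    and b: "\<forall>\<^sub>F n in sequentially. norm (b n) \<le> B n" "B \<longlonglongrightarrow> d"
    and lim: "(\<lambda>n. norm ((1 - t n) *\<^sub>R a n + t n *\<^sub>R b n)) \<longlonglongrightarrow> d"
  shows "(\<lambda>n. a n - b n) \<longlonglongrightarrow> 0"
proof (rule tendstoI)
  fix \<epsilon> :: real assume "0 < \<epsilon>"
  have "0 \<le> d" using lim by (rule LIMSEQ_le_const) auto
  obtain \<eta> where \<eta>: "0 < \<eta>"
    "\<And>(a::'a) b t. \<lbrakk>c \<le> t; t \<le> 1 - c; norm a \<le> d + \<eta>; norm b \<le> d + \<eta>;
       d - \<eta> \<le> norm ((1 - t) *\<^sub>R a + t *\<^sub>R b)\<rbrakk> \<Longrightarrow> norm (a - b) < \<epsilon>"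
    using uniformly_convex_combination[OF uc \<open>0 \<le> d\<close> \<open>0 < \<epsilon>\<close> \<open>0 < c\<close>] by blast
  have "\<forall>\<^sub>F n in sequentially. A n < d + \<eta>" "\<forall>\<^sub>F n in sequentially. B n < d + \<eta>"
    using order_tendstoD(2)[OF a(2), of "d + \<eta>"] order_tendstoD(2)[OF b(2), of "d + \<eta>"] \<eta>(1)
    by simp_all
  moreover have "\<forall>\<^sub>F n in sequentially. d - \<eta> < norm ((1 - t n) *\<^sub>R a n + t n *\<^sub>R b n)"
    using order_tendstoD(1)[OF lim, of "d - \<eta>"] \<eta>(1) by simp
  ultimately show "\<forall>\<^sub>F n in sequentially. dist (a n - b n) 0 < \<epsilon>"
    using t a(1) b(1) by eventually_elim (auto intro!: \<eta>(2))
qed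

section \<open>Weak sequential compactness\<close>

text \<open>The hulls shrink with \<open>n\<close>, so for bounded \<open>x\<close> and infinite
  \<open>A\<close> the distances increase to this supremum. \<open>infdist\<close> avoids asking
  that a minimum be attained.\<close>

definition tail_norm :: "(nat \<Rightarrow> 'a::real_normed_vector) \<Rightarrow> nat set \<Rightarrow> real" where
  "tail_norm x A = (SUP n. infdist 0 (convex hull (x ` (A \<inter> {n..}))))"

lemma tail_nonempty: "infinite A \<Longrightarrow> A \<inter> {n..} \<noteq> {}" for A :: "nat set"
  unfolding infinite_nat_iff_unbounded_le by fastforce

lemma infdist_tail_le:
  fixes x :: "nat \<Rightarrow> 'a::real_normed_vector"
  assumes "infinite A" "\<And>n. norm (x n) \<le> R"
  shows "infdist 0 (convex hull (x ` (A \<inter> {n..}))) \<le> R"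
proof -
  obtain m where "m \<in> A \<inter> {n..}" using tail_nonempty[OF assms(1)] by blast
  then have "infdist 0 (convex hull (x ` (A \<inter> {n..}))) \<le> dist 0 (x m)"
    by (intro infdist_le hull_inc) auto
  then show ?thesis using assms(2)[of m] by simp
qed

lemma infdist_le_tail_norm:
  fixes x :: "nat \<Rightarrow> 'a::real_normed_vector"
  assumes "infinite A" "\<And>n. norm (x n) \<le> R"
  shows "infdist 0 (convex hull (x ` (A \<inter> {n..}))) \<le> tail_norm x A"
  unfolding tail_norm_def
  using infdist_tail_le[of A x R] assms by (intro cSUP_upper bdd_aboveI2) auto

lemma tail_norm_le:
  fixes x :: "nat \<Rightarrow> 'a::real_normed_vector"
  assumes "infinite A" "\<And>n. norm (x n) \<le> R"
  shows "tail_norm x A \<le> R"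
  unfolding tail_norm_def using infdist_tail_le[of A x R] assms by (intro cSUP_least) auto

text \<open>A tail of \<open>A\<close> starting beyond the finitely many points outside
  \<open>B\<close> lies in \<open>B\<close>, and a smaller hull is at least as far from
  \<open>0\<close>. Working modulo finite sets makes this applicable to diagonal sets.\<close>

lemma tail_norm_mono:
  fixes x :: "nat \<Rightarrow> 'a::real_normed_vector"
  assumes "infinite A" "finite (A - B)" "\<And>n. norm (x n) \<le> R"
  shows "tail_norm x B \<le> tail_norm x A"
proof -
  obtain m where m: "\<And>i. i \<in> A - B \<Longrightarrow> i < m"
    using assms(2) by (auto simp: finite_nat_set_iff_bounded)
  have "infdist 0 (convex hull (x ` (B \<inter> {n..}))) \<le> tail_norm x A" for n
  proof -
    have "infdist 0 (convex hull (x ` (B \<inter> {n..})))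
        \<le> infdist 0 (convex hull (x ` (A \<inter> {max m n..})))"
    proof (rule infdist_mono)
      show "convex hull (x ` (A \<inter> {max m n..})) \<subseteq> convex hull (x ` (B \<inter> {n..}))"
        using m by (intro hull_mono image_mono) force
    qed (use tail_nonempty[OF assms(1)] in simp)
    also have "\<dots> \<le> tail_norm x A"
      by (rule infdist_le_tail_norm[OF assms(1,3)])
    finally show ?thesis .
  qed
  then show ?thesis unfolding tail_norm_def[of x B] by (intro cSUP_least) auto
qed

text \<open>A greedy choice: each \<open>Q (Suc n)\<close> comes within \<open>1 / Suc n\<close> of
  the supremum \<open>S (Q n)\<close> over the infinite subsets of \<open>Q n\<close>. A diagonal
  set leaves no room for a further increase.\<close>

lemma exists_tail_norm_stable:
  fixes x :: "nat \<Rightarrow> 'a::real_normed_vector"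
  assumes "infinite A0" and x: "\<And>n. norm (x n) \<le> R"
  shows "\<exists>A\<subseteq>A0. infinite A \<and> (\<forall>B\<subseteq>A. infinite B \<longrightarrow> tail_norm x B = tail_norm x A)"
proof -
  define S where "S A = (SUP B\<in>{B. B \<subseteq> A \<and> infinite B}. tail_norm x B)" for A
  have step: "\<exists>B. (B \<subseteq> A \<and> infinite B) \<and> (B \<subseteq> A \<and> S A - 1 / Suc n \<le> tail_norm x B)"
    if "A \<subseteq> A0 \<and> infinite A" for A n
  proof -
    let ?V = "tail_norm x ` {B. B \<subseteq> A \<and> infinite B}"
    have "?V \<noteq> {}" using that by blast
    moreover have "S A - 1 / Suc n < Sup ?V" by (simp add: S_def)
    ultimately obtain v where "v \<in> ?V" "S A - 1 / Suc n < v" by (meson less_cSupD)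
    then obtain B where "B \<subseteq> A" "infinite B" "S A - 1 / Suc n < tail_norm x B" by blast
    then show ?thesis by (intro exI[of _ B]) simp
  qed
  have "\<exists>Q. \<forall>n. (Q n \<subseteq> A0 \<and> infinite (Q n)) \<and>
      (Q (Suc n) \<subseteq> Q n \<and> S (Q n) - 1 / Suc n \<le> tail_norm x (Q (Suc n)))"
  proof (rule dependent_nat_choice)
    fix A n assume "A \<subseteq> A0 \<and> infinite A"
    with step[of A n] show "\<exists>B. (B \<subseteq> A0 \<and> infinite B) \<and> (B \<subseteq> A \<and> S A - 1 / Suc n \<le> tail_norm x B)"
      by (metis order_trans)
  qed (use assms(1) in blast)
  then obtain Q where Q: "\<And>n. Q n \<subseteq> A0" "\<And>n. infinite (Q n)" "\<And>n. Q (Suc n) \<subseteq> Q n"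
    "\<And>n. S (Q n) - 1 / Suc n \<le> tail_norm x (Q (Suc n))"
    by blast
  have "\<exists>m. m \<in> Q n \<and> n < m" for n
    using Q(2)[of n] by (meson infinite_nat_iff_unbounded)
  then obtain q where q: "\<And>n. q n \<in> Q n" "\<And>n. n < q n" by metis
  \<comment> \<open>As the \<open>Q n\<close> decrease, only \<open>q i\<close> with
    \<open>i < n\<close> can fall outside \<open>Q n\<close>; \<open>n < q n\<close> makes the range
    infinite.\<close>
  define A where "A = range q"
  have infA: "infinite A"
    unfolding A_def infinite_nat_iff_unbounded using q(2) by blast
  have almost: "finite (A - Q n)" for n
  proof -
    have "q i \<in> Q n" if "n \<le> i" for i
      using q(1)[of i] lift_Suc_antimono_le[of Q, OF Q(3) that] by blast
    then have "A - Q n \<subseteq> q ` {..<n}" by (force simp: A_def not_le[symmetric])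
    then show ?thesis by (rule finite_subset) simp
  qed
  show ?thesis
  proof (intro exI[of _ A] conjI allI impI)
    show "A \<subseteq> A0" using q(1) Q(1) by (auto simp: A_def)
    fix B assume B: "B \<subseteq> A" "infinite B"
    have "finite (B - A)" using B by (metis Diff_eq_empty_iff finite.emptyI)
    then have lower: "tail_norm x A \<le> tail_norm x B"
      by (rule tail_norm_mono[OF B(2) _ x])
    \<comment> \<open>\<open>B \<inter> Q n\<close> is an infinite subset of \<open>Q n\<close>, so
      it competes in \<open>S (Q n)\<close>, which \<open>Q (Suc n)\<close> nearly attains; and
      \<open>A\<close> lies in \<open>Q (Suc n)\<close> up to a finite set.\<close>
    have upper: "tail_norm x B \<le> tail_norm x A + 1 / Suc n" for n
    proof -
      have "finite (B - Q n)" by (rule finite_subset[OF _ almost[of n]]) (use B in auto)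
      then have inf: "infinite (B \<inter> Q n)"
        using B(2) by (metis Diff_Diff_Int Diff_infinite_finite)
      have "finite (B \<inter> Q n - B)" by (metis Diff_eq_empty_iff finite.emptyI inf_le1)
      then have "tail_norm x B \<le> tail_norm x (B \<inter> Q n)"
        by (rule tail_norm_mono[OF inf _ x])
      also have "\<dots> \<le> S (Q n)"
        unfolding S_def using inf
        by (intro cSUP_upper bdd_aboveI2[of _ _ R] tail_norm_le[OF _ x]) auto
      also have "\<dots> \<le> tail_norm x (Q (Suc n)) + 1 / Suc n"
        using Q(4)[of n] by simp
      also have "tail_norm x (Q (Suc n)) \<le> tail_norm x A"
        by (rule tail_norm_mono[OF infA almost x])
      finally show ?thesis by simp
    qed
    have "tail_norm x B \<le> tail_norm x A"
    proof (rule field_le_epsilon)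
      fix e :: real assume "0 < e"
      then obtain n where "1 / Suc n < e" using nat_approx_posE by blast
      with upper[of n] show "tail_norm x B \<le> tail_norm x A + e" by simp
    qed
    with lower show "tail_norm x B = tail_norm x A" by simp
  qed (rule infA)
qed

text \<open>One \<open>l\<close> serves every \<open>B\<close>: with equal limiting distance
  \<open>d\<close>, almost minimal points of the tails of \<open>B\<close> are almost minimal for
  the tails of \<open>A\<close> too, and such points are close together.\<close>

lemma exists_in_closure_tails:
  fixes x :: "nat \<Rightarrow> 'a::banach"
  assumes uc: "uniformly_convex TYPE('a)" and A: "infinite A" and x: "\<And>n. norm (x n) \<le> R"
  shows "\<exists>l. \<forall>B\<subseteq>A. \<forall>n. infinite B \<longrightarrow> tail_norm x B = tail_norm x A \<longrightarrow>
    l \<in> closure (convex hull (x ` (B \<inter> {n..})))"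
proof -
  define d where "d = tail_norm x A"
  let ?H = "\<lambda>B n. convex hull (x ` (B \<inter> {n..}))"
  have mono: "?H B n \<subseteq> ?H B' m" if "B \<subseteq> B'" "m \<le> n" for B B' m n
    using that by (intro hull_mono image_mono) auto
  have "0 \<le> infdist 0 (?H A 0)" by (rule infdist_nonneg)
  then have d0: "0 \<le> d"
    unfolding d_def by (rule order_trans) (rule infdist_le_tail_norm[OF A x])
  have near: "\<exists>p\<in>?H B n. norm p < d + \<eta>"
    if B: "infinite B" "tail_norm x B = d" and "0 < \<eta>" for B n \<eta>
  proof -
    have "infdist 0 (?H B n) < d + \<eta>"
      using infdist_le_tail_norm[OF B(1), of x R n] x B(2) \<open>0 < \<eta>\<close> by simp
    moreover have "?H B n \<noteq> {}" using tail_nonempty[OF B(1)] by simp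
    ultimately show ?thesis
      using cInf_lessD[of "dist 0 ` ?H B n" "d + \<eta>"] by (auto simp: infdist_notempty)
  qed
  \<comment> \<open>The midpoint of \<open>p\<close> and \<open>q\<close> stays in the hull, so its
    norm exceeds \<open>d - \<eta>\<close> for suitable \<open>m\<close>; uniform convexity then
    bounds \<open>dist p q\<close>.\<close>
  have close: "\<exists>\<eta> m. 0 < \<eta> \<and> (\<forall>p\<in>?H A m. \<forall>q\<in>?H A m.
      norm p < d + \<eta> \<longrightarrow> norm q < d + \<eta> \<longrightarrow> dist p q < \<epsilon>)" if "0 < \<epsilon>" for \<epsilon>
  proof -
    have "0 < (1/2::real)" by simp
    from uniformly_convex_combination[OF uc d0 \<open>0 < \<epsilon>\<close> this] obtain \<eta> where \<eta>: "0 < \<eta>"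
      "\<forall>(a::'a) b t. 1/2 \<le> t \<longrightarrow> t \<le> 1 - 1/2 \<longrightarrow> norm a \<le> d + \<eta> \<longrightarrow> norm b \<le> d + \<eta> \<longrightarrow>
         d - \<eta> \<le> norm ((1 - t) *\<^sub>R a + t *\<^sub>R b) \<longrightarrow> norm (a - b) < \<epsilon>"
      by blast
    have "d - \<eta> < (SUP n. infdist 0 (?H A n))"
      using \<eta>(1) by (simp add: d_def tail_norm_def)
    then obtain m where m: "d - \<eta> < infdist 0 (?H A m)"
      using less_cSupD[of "range (\<lambda>n. infdist 0 (?H A n))" "d - \<eta>"] by auto
    have "dist p q < \<epsilon>"
      if p: "p \<in> ?H A m" "norm p < d + \<eta>" and q: "q \<in> ?H A m" "norm q < d + \<eta>" for p q
    proof -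
      have "(1 - 1/2) *\<^sub>R p + (1/2) *\<^sub>R q \<in> ?H A m"
        using p q by (intro convexD[OF convex_convex_hull]) auto
      then have "infdist 0 (?H A m) \<le> norm ((1 - 1/2) *\<^sub>R p + (1/2) *\<^sub>R q)"
        by (metis infdist_le dist_0_norm)
      then show ?thesis
        unfolding dist_norm using p q m by (intro \<eta>(2)[rule_format, of "1/2"]) auto
    qed
    with \<eta>(1) show ?thesis by blast
  qed
  have "\<forall>n. \<exists>p. p \<in> ?H A n \<and> norm p < d + 1 / Suc n"
    using near[OF A d_def[symmetric]] by (metis of_nat_0_less_iff zero_less_Suc zero_less_divide_1_iff)
  then obtain p where p: "\<And>n. p n \<in> ?H A n" "\<And>n. norm (p n) < d + 1 / Suc n" by metis
  have p_near: "\<exists>m0. \<forall>n\<ge>m0. p n \<in> ?H A m \<and> norm (p n) < d + \<eta>" if \<eta>: "0 < \<eta>" for \<eta> m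
  proof -
    obtain n0 where n0: "1 / Suc n0 < \<eta>" using \<eta> nat_approx_posE by blast
    have "norm (p n) < d + \<eta>" if "n0 \<le> n" for n
    proof -
      have "1 / Suc n \<le> 1 / Suc n0" using that by (intro divide_left_mono) auto
      then show ?thesis using p(2)[of n] n0 by simp
    qed
    moreover have "p n \<in> ?H A m" if "m \<le> n" for n
      using p(1)[of n] mono[OF order_refl that] by blast
    ultimately show ?thesis by (intro exI[of _ "max m n0"]) auto
  qed
  have "Cauchy p"
  proof (rule metric_CauchyI)
    fix \<epsilon> :: real assume "0 < \<epsilon>"
    from close[OF this] obtain \<eta> m where *: "0 < \<eta>" "\<forall>p\<in>?H A m. \<forall>q\<in>?H A m.
      norm p < d + \<eta> \<longrightarrow> norm q < d + \<eta> \<longrightarrow> dist p q < \<epsilon>" by blast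
    from p_near[OF *(1), of m] * show "\<exists>M. \<forall>m\<ge>M. \<forall>n\<ge>M. dist (p m) (p n) < \<epsilon>" by meson
  qed
  then obtain l where l: "p \<longlonglongrightarrow> l" using Cauchy_convergent convergent_def by blast
  show ?thesis
  proof (intro exI[of _ l] allI impI)
    fix B n assume B: "B \<subseteq> A" "infinite B" "tail_norm x B = tail_norm x A"
    show "l \<in> closure (?H B n)"
      unfolding closure_approachable
    proof (intro allI impI)
      fix \<epsilon> :: real assume "0 < \<epsilon>"
      from close[of "\<epsilon>/2"] \<open>0 < \<epsilon>\<close> obtain \<eta> m where *: "0 < \<eta>" "\<forall>p\<in>?H A m. \<forall>q\<in>?H A m.
        norm p < d + \<eta> \<longrightarrow> norm q < d + \<eta> \<longrightarrow> dist p q < \<epsilon>/2" by auto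
      \<comment> \<open>The tail from \<open>max n m\<close> puts \<open>q\<close> both in the hull
        in question and in the tail of \<open>A\<close> to which the choice of \<open>m\<close>
        applies.\<close>
      obtain q where q: "q \<in> ?H B (max n m)" "norm q < d + \<eta>"
        using near[OF B(2) _ *(1)] B(3) d_def by blast
      obtain m0 where m0: "\<forall>i\<ge>m0. p i \<in> ?H A m \<and> norm (p i) < d + \<eta>"
        using p_near[OF *(1), of m] by blast
      obtain m1 where m1: "\<forall>i\<ge>m1. dist (p i) l < \<epsilon>/2"
        using metric_LIMSEQ_D[OF l, of "\<epsilon>/2"] \<open>0 < \<epsilon>\<close> by auto
      let ?i = "max m0 m1"
      have "q \<in> ?H A m" using q(1) mono[OF B(1), of m "max n m"] by auto
      then have "dist q (p ?i) < \<epsilon>/2" using * q(2) m0 by simp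
      moreover have "dist (p ?i) l < \<epsilon>/2" using m1 by simp
      ultimately have "dist q l < \<epsilon>"
        using dist_triangle[of q l "p ?i"] by linarith
      moreover have "q \<in> ?H B n"
        using q(1) mono[of B B n "max n m"] by auto
      ultimately show "\<exists>y\<in>?H B n. dist y l < \<epsilon>" by blast
    qed
  qed
qed

text \<open>The index set \<open>A0\<close> is prescribed so that the lemma also applies to the
  indices at which a functional stays away from a given value.\<close>

lemma bounded_weakly_convergent_subsequence:
  fixes x :: "nat \<Rightarrow> 'a::banach"
  assumes uc: "uniformly_convex TYPE('a)" and A0: "infinite A0" and bdd: "bounded (range x)"
    and K: "closed K" "convex K" "range x \<subseteq> K"
  obtains r l where "strict_mono r" "range r \<subseteq> A0" "l \<in> K" "weakly_converges (x \<circ> r) l"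
proof -
  obtain R where R: "\<And>n. norm (x n) \<le> R"
    using bdd by (auto simp: bounded_iff)
  obtain A where A: "A \<subseteq> A0" "infinite A"
    "\<forall>B\<subseteq>A. infinite B \<longrightarrow> tail_norm x B = tail_norm x A"
    using exists_tail_norm_stable[OF A0, of x R] R by blast
  obtain l where l: "\<forall>B\<subseteq>A. \<forall>n. infinite B \<longrightarrow> tail_norm x B = tail_norm x A \<longrightarrow>
    l \<in> closure (convex hull (x ` (B \<inter> {n..})))"
    using exists_in_closure_tails[OF uc A(2), of x R] R by blast
  \<comment> \<open>Stability of \<open>A\<close> makes every infinite \<open>B\<close> admissible
    in \<open>l\<close>, and the tail from \<open>0\<close> is all of \<open>B\<close>.\<close>
  have mem: "l \<in> S" if "closed S" "convex S" "B \<subseteq> A" "infinite B" "x ` B \<subseteq> S" for S B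
  proof -
    have "closure (convex hull (x ` (B \<inter> {0..}))) \<subseteq> S"
      using that by (intro closure_minimal hull_minimal) auto
    moreover have "l \<in> closure (convex hull (x ` (B \<inter> {0..})))"
      using l A(3) that(3,4) by blast
    ultimately show ?thesis by blast
  qed
  \<comment> \<open>Half-spaces are closed and convex, so infinitely many such indices would force
    \<open>l\<close> into one that excludes it.\<close>
  have fin: "finite {n \<in> A. f l + \<epsilon> \<le> f (x n)}" if f: "bounded_linear f" and "0 < \<epsilon>"
    for f :: "'a \<Rightarrow> real" and \<epsilon>
  proof (rule ccontr)
    assume inf: "infinite {n \<in> A. f l + \<epsilon> \<le> f (x n)}"
    have "closed {z. f l + \<epsilon> \<le> f z}"
      by (intro closed_Collect_le continuous_on_const linear_continuous_on f)
    moreover have "convex {z. f l + \<epsilon> \<le> f z}"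
    proof -
      have "{z. f l + \<epsilon> \<le> f z} = f -` {f l + \<epsilon>..}" by auto
      then show ?thesis using f by (simp add: convex_linear_vimage bounded_linear.linear)
    qed
    ultimately have "l \<in> {z. f l + \<epsilon> \<le> f z}"
      using inf by (intro mem[where B = "{n \<in> A. f l + \<epsilon> \<le> f (x n)}"]) auto
    with \<open>0 < \<epsilon>\<close> show False by simp
  qed
  \<comment> \<open>All of \<open>A\<close>, listed increasingly, converges weakly: applying
    \<open>fin\<close> to \<open>f\<close> and to \<open>- f\<close> leaves finitely many
    exceptions.\<close>
  let ?r = "enumerate A"
  have r: "strict_mono ?r" "range ?r = A"
    using strict_mono_enumerate[OF A(2)] range_enumerate[OF A(2)] by auto
  have "weakly_converges (x \<circ> ?r) l"
    unfolding weakly_converges_def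
  proof (intro allI impI tendstoI)
    fix f :: "'a \<Rightarrow> real" and \<epsilon> :: real
    assume f: "bounded_linear f" and "0 < \<epsilon>"
    have "finite {n \<in> A. f l + \<epsilon> \<le> f (x n)}" "finite {n \<in> A. - f l + \<epsilon> \<le> - f (x n)}"
      using fin[OF f \<open>0 < \<epsilon>\<close>] fin[OF bounded_linear_minus[OF f] \<open>0 < \<epsilon>\<close>] by auto
    then have "finite ({n \<in> A. f l + \<epsilon> \<le> f (x n)} \<union> {n \<in> A. - f l + \<epsilon> \<le> - f (x n)})"
      by simp
    then have "finite {n \<in> A. \<epsilon> \<le> dist (f (x n)) (f l)}"
      by (rule finite_subset[rotated]) (auto simp: dist_real_def)
    then have "finite (?r -` {n \<in> A. \<epsilon> \<le> dist (f (x n)) (f l)})"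
      using strict_mono_imp_inj_on[OF r(1)] by (intro finite_vimageI) auto
    moreover have "?r -` {n \<in> A. \<epsilon> \<le> dist (f (x n)) (f l)} = {n. \<not> dist (f ((x \<circ> ?r) n)) (f l) < \<epsilon>}"
      using r(2) by auto
    ultimately show "\<forall>\<^sub>F n in sequentially. dist (f ((x \<circ> ?r) n)) (f l) < \<epsilon>"
      by (simp add: cofinite_eq_sequentially[symmetric] eventually_cofinite)
  qed
  moreover have "l \<in> K" using K A(2) by (intro mem[of K A]) auto
  ultimately show ?thesis using that r A(1) by blast
qed

section \<open>Implicit iteration with cyclic control\<close>

text \<open>Dividing by the bounded products \<open>P n\<close> turns the recursion into growth by
  at most \<open>c n\<close>. Hence \<open>e\<close>, the quotient minus the partial sums of
  \<open>c\<close>, decreases and is bounded below.\<close>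

lemma convergent_of_recursive_bound:
  fixes a b c :: "nat \<Rightarrow> real"
  assumes nonneg: "\<And>n. 0 \<le> a n" "\<And>n. 0 \<le> b n" "\<And>n. 0 \<le> c n"
    and rec: "\<And>n. a (Suc n) \<le> (1 + b n) * a n + c n"
    and "summable b" "summable c"
  shows "convergent a"
proof -
  define P where "P n = (\<Prod>i<n. 1 + b i)" for n
  have P1: "1 \<le> P n" for n
    unfolding P_def by (intro prod_ge_1) (simp add: nonneg)
  have "P n \<le> exp (suminf b)" for n
  proof -
    have "P n \<le> (\<Prod>i<n. exp (b i))"
      unfolding P_def by (intro prod_mono) (simp add: nonneg add_nonneg_nonneg)
    also have "\<dots> = exp (\<Sum>i<n. b i)" by (simp add: exp_sum)
    also have "\<dots> \<le> exp (suminf b)"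
      using sum_le_suminf[OF \<open>summable b\<close>] nonneg by simp
    finally show ?thesis .
  qed
  moreover have "incseq P"
  proof (rule incseq_SucI)
    fix n show "P n \<le> P (Suc n)"
      using mult_left_mono[of 1 "1 + b n" "P n"] P1[of n] nonneg(2)[of n] by (simp add: P_def)
  qed
  ultimately have convP: "convergent P"
    by (metis incseq_convergent convergentI)
  define e where "e n = a n / P n - (\<Sum>i<n. c i)" for n
  have "e (Suc n) \<le> e n" for n
  proof -
    have PS: "P (Suc n) = P n * (1 + b n)" by (simp add: P_def)
    have "a (Suc n) / P (Suc n) \<le> ((1 + b n) * a n + c n) / P (Suc n)"
      using rec P1[of "Suc n"] by (intro divide_right_mono) auto
    also have "\<dots> = a n / P n + c n / P (Suc n)"
      using P1[of n] nonneg(2)[of n] by (simp add: PS add_divide_distrib)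
    also have "c n / P (Suc n) \<le> c n / 1"
      using P1[of "Suc n"] nonneg(3)[of n] by (intro divide_left_mono) auto
    finally show ?thesis by (simp add: e_def)
  qed
  then have "decseq e" by (rule decseq_SucI)
  moreover have "- suminf c \<le> e n" for n
  proof -
    have "0 \<le> a n / P n" using nonneg(1)[of n] P1[of n] by simp
    then show ?thesis
      using sum_le_suminf[OF \<open>summable c\<close>, of "{..<n}"] nonneg by (simp add: e_def)
  qed
  ultimately have "convergent e"
    by (metis decseq_convergent convergentI)
  moreover have "convergent (\<lambda>n. \<Sum>i<n. c i)"
    using \<open>summable c\<close> by (simp add: summable_iff_convergent)
  ultimately have "convergent (\<lambda>n. P n * (e n + (\<Sum>i<n. c i)))"
    by (intro convergent_mult convergent_add convP)
  moreover have "P n * (e n + (\<Sum>i<n. c i)) = a n" for n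
    using P1[of n] by (simp add: e_def)
  ultimately show ?thesis by simp
qed

text \<open>Every value \<open>g m\<close> is repeated \<open>N\<close> times. This carries
  summability from the running index over to the cycle counter \<open>k\<close>.\<close>

lemma summable_comp_div:
  fixes g :: "nat \<Rightarrow> real"
  assumes "\<And>n. 0 \<le> g n" "summable g" "N \<ge> 1"
  shows "summable (\<lambda>n. g (n div N))"
proof (rule summableI_nonneg_bounded)
  fix n
  have "(\<Sum>i<n. g (i div N)) \<le> (\<Sum>i<n * N. g (i div N))"
    using assms by (intro sum_mono2) auto
  also have "\<dots> = (\<Sum>m<n. \<Sum>i = m * N..<m * N + N. g (i div N))"
    by (rule sum.nat_group[symmetric])
  also have "\<dots> = (\<Sum>m<n. N * g m)"
  proof (rule sum.cong[OF refl])
    fix m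
    have "i div N = m" if "i \<in> {m * N..<m * N + N}" for i
      using that by (intro div_nat_eqI) (auto simp: mult.commute)
    then have "(\<Sum>i = m * N..<m * N + N. g (i div N)) = (\<Sum>i = m * N..<m * N + N. g m)"
      by (intro sum.cong) auto
    then show "(\<Sum>i = m * N..<m * N + N. g (i div N)) = N * g m" by simp
  qed
  also have "\<dots> \<le> N * suminf g"
    using sum_le_suminf[OF assms(2), of "{..<n}"] assms(1)
    by (simp add: sum_distrib_left[symmetric] mult_left_mono)
  finally show "(\<Sum>i<n. g (i div N)) \<le> N * suminf g" .
qed (use assms in simp)

section \<open>Convex combinations with error terms\<close>

lemma convex_combination3_mem:
  assumes "convex K" "p \<in> K" "q \<in> K" "r \<in> K"
    and "0 \<le> a" "0 \<le> b" "0 \<le> c" "a + b + c = (1::real)"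
  shows "a *\<^sub>R p + b *\<^sub>R q + c *\<^sub>R r \<in> K"
proof -
  have "a *\<^sub>R p + b *\<^sub>R q + c *\<^sub>R r \<in> convex hull {p, q, r}"
    unfolding convex_hull_3 using assms by blast
  then show ?thesis using hull_minimal[of "{p, q, r}" K convex] assms by blast
qed

lemma norm_combination3_diff:
  fixes p q r z :: "'a::real_normed_vector"
  assumes "0 \<le> a" "0 \<le> b" "0 \<le> c" "a + b + c = 1"
  shows "norm (a *\<^sub>R p + b *\<^sub>R q + c *\<^sub>R r - z) \<le> a * norm (p - z) + b * norm (q - z) + c * norm (r - z)"
proof -
  have "z = a *\<^sub>R z + b *\<^sub>R z + c *\<^sub>R z"
    using assms by (simp add: scaleR_add_left[symmetric])
  then have "a *\<^sub>R p + b *\<^sub>R q + c *\<^sub>R r - z = a *\<^sub>R (p - z) + b *\<^sub>R (q - z) + c *\<^sub>R (r - z)"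
    by (simp add: algebra_simps)
  then show ?thesis
    using norm_triangle_ineq[of "a *\<^sub>R (p - z) + b *\<^sub>R (q - z)" "c *\<^sub>R (r - z)"]
      norm_triangle_ineq[of "a *\<^sub>R (p - z)" "b *\<^sub>R (q - z)"] assms by simp
qed

text \<open>Adding the vanishing vector \<open>r n *\<^sub>R (e n - a n)\<close> to both
  \<open>a n - p\<close> and \<open>b n - p\<close> keeps their difference and makes
  \<open>w n - p\<close> an exact two-point combination with weight \<open>t n\<close>.\<close>

lemma uniformly_convex_tendsto_diff_error:
  fixes w a b e :: "nat \<Rightarrow> 'a::real_normed_vector"
  assumes uc: "uniformly_convex TYPE('a)"
    and "0 < c" and t: "\<forall>\<^sub>F n in sequentially. c \<le> t n \<and> t n \<le> 1 - c"
    and w: "\<forall>\<^sub>F n in sequentially. w n = s n *\<^sub>R a n + t n *\<^sub>R b n + r n *\<^sub>R e n \<and> s n + t n + r n = 1"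
    and r: "r \<longlonglongrightarrow> 0" and e: "\<forall>\<^sub>F n in sequentially. norm (e n - a n) \<le> D"
    and a: "(\<lambda>n. norm (a n - p)) \<longlonglongrightarrow> d"
    and b: "\<forall>\<^sub>F n in sequentially. norm (b n - p) \<le> B n" "B \<longlonglongrightarrow> d"
    and lim: "(\<lambda>n. norm (w n - p)) \<longlonglongrightarrow> d"
  shows "(\<lambda>n. a n - b n) \<longlonglongrightarrow> 0"
proof -
  define a' where "a' n = a n - p + r n *\<^sub>R (e n - a n)" for n
  define b' where "b' n = b n - p + r n *\<^sub>R (e n - a n)" for n
  have r0: "(\<lambda>n. \<bar>r n\<bar> * D) \<longlonglongrightarrow> 0"
    using tendsto_mult_right[OF tendsto_rabs_zero[OF r], of D] by simp
  have err: "\<forall>\<^sub>F n in sequentially. norm (r n *\<^sub>R (e n - a n)) \<le> \<bar>r n\<bar> * D"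
    using e by eventually_elim (simp add: mult_left_mono)
  have A: "\<forall>\<^sub>F n in sequentially. norm (a' n) \<le> norm (a n - p) + \<bar>r n\<bar> * D"
    using err
  proof eventually_elim
    case (elim n)
    then show ?case
      unfolding a'_def by (intro norm_triangle_le) simp
  qed
  have B: "\<forall>\<^sub>F n in sequentially. norm (b' n) \<le> B n + \<bar>r n\<bar> * D"
    using err b(1)
  proof eventually_elim
    case (elim n)
    then show ?case
      unfolding b'_def by (intro norm_triangle_le) simp
  qed
  have "\<forall>\<^sub>F n in sequentially. w n - p = (1 - t n) *\<^sub>R a' n + t n *\<^sub>R b' n"
    using w
  proof eventually_elim
    case (elim n)
    then have "s n = 1 - t n - r n" by simp
    with elim have "w n = (1 - t n - r n) *\<^sub>R a n + t n *\<^sub>R b n + r n *\<^sub>R e n" by metis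
    then show ?case by (simp add: a'_def b'_def algebra_simps)
  qed
  then have "\<forall>\<^sub>F n in sequentially. norm (w n - p) = norm ((1 - t n) *\<^sub>R a' n + t n *\<^sub>R b' n)"
    by eventually_elim simp
  from Lim_transform_eventually[OF lim this]
  have "(\<lambda>n. norm ((1 - t n) *\<^sub>R a' n + t n *\<^sub>R b' n)) \<longlonglongrightarrow> d" .
  then have "(\<lambda>n. a' n - b' n) \<longlonglongrightarrow> 0"
    using tendsto_add[OF a r0] tendsto_add[OF b(2) r0]
    by (intro uniformly_convex_tendsto_diff[OF uc \<open>0 < c\<close> t A _ B]) simp_all
  then show ?thesis by (simp add: a'_def b'_def)
qed

section \<open>Cyclic control and approximate fixed points\<close>

lemma funpow_mem: "S \<in> K \<rightarrow> K \<Longrightarrow> z \<in> K \<Longrightarrow> (S ^^ n) z \<in> K"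
  by (induction n) auto

lemma cyclic_index_eq:
  assumes "N \<ge> 1" "k \<ge> 1" "j \<in> {1..N}" "n = (k - 1) * N + j"
  shows "k = Suc ((n - 1) div N)" "j = Suc ((n - 1) mod N)"
proof -
  have n: "n - 1 = (j - 1) + N * (k - 1)" "j - 1 < N" using assms by (auto simp: mult.commute)
  have "(n - 1) div N = k - 1" "(n - 1) mod N = j - 1"
    unfolding n(1) using n(2) assms(1) by simp_all
  then show "k = Suc ((n - 1) div N)" "j = Suc ((n - 1) mod N)" using assms by auto
qed

text \<open>The map \<open>S (j n)\<close> is first handled at its own index by comparing two visits
  \<open>N\<close> steps apart; an arbitrary \<open>S i\<close> is then reached because
  \<open>i\<close> occurs among any \<open>N\<close> consecutive values of \<open>j\<close>.\<close>

lemma cyclic_iterates_asymptotically_fixed: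
  fixes S :: "nat \<Rightarrow> 'a::real_normed_vector \<Rightarrow> 'a" and x :: "nat \<Rightarrow> 'a"
  assumes "N \<ge> 1"
    and maps: "\<forall>i\<in>{1..N}. S i \<in> K \<rightarrow> K"
    and lip: "\<forall>i\<in>{1..N}. uniformly_lipschitzian K (S i) L"
    and kj: "\<forall>n\<ge>1. k n \<ge> 1 \<and> j n \<in> {1..N} \<and> n = (k n - 1) * N + j n"
    and x: "\<forall>n. x n \<in> K"
    and step: "(\<lambda>n. x (Suc n) - x n) \<longlonglongrightarrow> 0"
    and iter: "(\<lambda>n. x n - (S (j n) ^^ k n) (x n)) \<longlonglongrightarrow> 0"
    and i: "i \<in> {1..N}"
  shows "(\<lambda>n. x n - S i (x n)) \<longlonglongrightarrow> 0"
proof -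
  have k_eq: "k n = Suc ((n - 1) div N)" and j_eq: "j n = Suc ((n - 1) mod N)"
    and jN: "j n \<in> {1..N}" and k1: "k n \<ge> 1" if "n \<ge> 1" for n
  proof -
    have *: "k n \<ge> 1" "j n \<in> {1..N}" "n = (k n - 1) * N + j n"
      using kj that by blast+
    show "j n \<in> {1..N}" "k n \<ge> 1" by (fact *)+
    show "k n = Suc ((n - 1) div N)" "j n = Suc ((n - 1) mod N)"
      using cyclic_index_eq[OF \<open>N \<ge> 1\<close> *] by blast+
  qed
  have L: "norm ((S i ^^ n) p - (S i ^^ n) q) \<le> L * norm (p - q)" "0 < L"
    if "i \<in> {1..N}" "p \<in> K" "q \<in> K" "n \<ge> 1" for i p q n
    using lip that unfolding uniformly_lipschitzian_def by blast+
  have L1: "norm (S i p - S i q) \<le> L * norm (p - q)"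
    if "i \<in> {1..N}" "p \<in> K" "q \<in> K" for i p q
    using L(1)[OF that, of 1] by simp
  have L0: "0 < L" using L(2)[OF i, of "x 0" "x 0" 1] x by simp
  have shift: "(\<lambda>n. x (n + m) - x n) \<longlonglongrightarrow> 0" for m
  proof (induction m)
    case (Suc m)
    have "(\<lambda>n. (x (Suc (n + m)) - x (n + m)) + (x (n + m) - x n)) \<longlonglongrightarrow> 0 + 0"
      by (intro tendsto_add Suc LIMSEQ_ignore_initial_segment[OF step])
    then show ?case by simp
  qed simp
  \<comment> \<open>At \<open>n + N\<close> the exponent is \<open>k n + 1\<close>, so the iterate
    of \<open>x (n + N)\<close> is \<open>S (j n)\<close> applied to its \<open>k n\<close>-th
    iterate. The latter is near \<open>x (n + N)\<close>, because this holds at \<open>x n\<close>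
    and \<open>x (n + N)\<close> is near \<open>x n\<close>.\<close>
  have own: "(\<lambda>n. x n - S (j n) (x n)) \<longlonglongrightarrow> 0"
  proof (rule LIMSEQ_offset[where k = N], rule Lim_null_comparison)
    let ?B = "\<lambda>n. norm (x (n + N) - (S (j (n + N)) ^^ k (n + N)) (x (n + N)))
      + L * ((L + 1) * norm (x (n + N) - x n) + norm (x n - (S (j n) ^^ k n) (x n)))"
    have "?B \<longlonglongrightarrow> norm (0::'a) + L * ((L + 1) * norm (0::'a) + norm (0::'a))"
      by (intro tendsto_intros shift iter LIMSEQ_ignore_initial_segment[OF iter])
    then show "?B \<longlonglongrightarrow> 0" by simp
    show "\<forall>\<^sub>F n in sequentially. norm (x (n + N) - S (j (n + N)) (x (n + N))) \<le> ?B n"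
      using eventually_ge_at_top[of 1]
    proof eventually_elim
      case (elim n)
      have j': "j (n + N) = j n" and k': "k (n + N) = Suc (k n)"
        using elim j_eq[of n] j_eq[of "n + N"] k_eq[of n] k_eq[of "n + N"] \<open>N \<ge> 1\<close>
        by (cases n; simp)+
      let ?S = "S (j n)" and ?z = "x (n + N)"
      have S: "?S \<in> K \<rightarrow> K" using maps jN[OF elim] by blast
      have zK: "?z \<in> K" "x n \<in> K" "(?S ^^ k n) ?z \<in> K" using x funpow_mem[OF S] by auto
      have "norm (?z - ?S ?z) \<le> norm (?z - (?S ^^ Suc (k n)) ?z) + norm ((?S ^^ Suc (k n)) ?z - ?S ?z)"
        using norm_triangle_ineq[of "?z - (?S ^^ Suc (k n)) ?z" "(?S ^^ Suc (k n)) ?z - ?S ?z"] by simp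
      also have "norm ((?S ^^ Suc (k n)) ?z - ?S ?z) \<le> L * norm ((?S ^^ k n) ?z - ?z)"
        using L1[OF jN[OF elim] zK(3,1)] by simp
      also have "norm ((?S ^^ k n) ?z - ?z)
          \<le> norm ((?S ^^ k n) ?z - (?S ^^ k n) (x n)) + norm (x n - (?S ^^ k n) (x n)) + norm (?z - x n)"
        using norm_triangle_ineq[of "(?S ^^ k n) ?z - (?S ^^ k n) (x n)" "(?S ^^ k n) (x n) - ?z"]
          norm_triangle_ineq[of "(?S ^^ k n) (x n) - x n" "x n - ?z"]
        by (simp add: norm_minus_commute)
      also have "norm ((?S ^^ k n) ?z - (?S ^^ k n) (x n)) \<le> L * norm (?z - x n)"
        by (rule L(1)[OF jN[OF elim] zK(1,2) k1[OF elim]])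
      finally show ?case using L0 unfolding j' k' by (simp add: algebra_simps)
    qed
  qed
  show ?thesis
  proof (rule Lim_null_comparison)
    \<comment> \<open>The number \<open>l\<close> of steps to the next use of \<open>S i\<close>
      varies with \<open>n\<close>; summing over all offsets removes this dependence.\<close>
    let ?b = "\<lambda>l n. (1 + L) * norm (x (n + l) - x n) + norm (x (n + l) - S (j (n + l)) (x (n + l)))"
    have "(\<lambda>n. \<Sum>l\<in>{1..N}. ?b l n) \<longlonglongrightarrow> (\<Sum>l\<in>{1..N}. (1 + L) * norm (0::'a) + norm (0::'a))"
      by (intro tendsto_intros shift LIMSEQ_ignore_initial_segment[OF own])
    then show "(\<lambda>n. \<Sum>l\<in>{1..N}. ?b l n) \<longlonglongrightarrow> 0" by simp
    have "norm (x n - S i (x n)) \<le> (\<Sum>l\<in>{1..N}. ?b l n)" for n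
    proof -
      \<comment> \<open>\<open>n + m\<close> is congruent to \<open>i - 1\<close> modulo
        \<open>N\<close>; the \<open>Suc\<close> below accounts for \<open>j\<close> counting from
        \<open>1\<close>.\<close>
      define m where "m = (i - 1 + (N - n mod N)) mod N"
      have "n mod N < N" using \<open>N \<ge> 1\<close> by simp
      have "(n + m) mod N = (n mod N + (i - 1 + (N - n mod N))) mod N"
        unfolding m_def by (simp add: mod_simps)
      also have "n mod N + (i - 1 + (N - n mod N)) = i - 1 + N"
        using \<open>n mod N < N\<close> by simp
      also have "(i - 1 + N) mod N = i - 1" using i by (subst mod_add_self2) auto
      finally have "j (n + Suc m) = i" using j_eq[of "n + Suc m"] i by simp
      moreover have "Suc m \<in> {1..N}" unfolding m_def using \<open>N \<ge> 1\<close> by (simp add: Suc_leI)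
      ultimately obtain l where l: "j (n + l) = i" "l \<in> {1..N}" by blast
      have "norm (x n - S i (x n)) \<le> norm (x (n + l) - x n) + norm (x (n + l) - S i (x (n + l)))
          + norm (S i (x (n + l)) - S i (x n))"
        using norm_triangle_ineq[of "x n - x (n + l)" "x (n + l) - S i (x n)"]
          norm_triangle_ineq[of "x (n + l) - S i (x (n + l))" "S i (x (n + l)) - S i (x n)"]
        by (simp add: norm_minus_commute)
      also have "\<dots> \<le> ?b l n"
        using L1[OF i, of "x (n + l)" "x n"] x l by (simp add: algebra_simps)
      also have "\<dots> \<le> (\<Sum>l\<in>{1..N}. ?b l n)"
        using l(2) L0 by (intro member_le_sum) auto
      finally show ?thesis .
    qed
    then show "\<forall>\<^sub>F n in sequentially. norm (x n - S i (x n)) \<le> (\<Sum>l\<in>{1..N}. ?b l n)" by simp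
  qed
qed

theorem theorem3p4:
  fixes K F :: "'a::banach set"
    and N :: nat
    and T I :: "nat \<Rightarrow> 'a \<Rightarrow> 'a"
    and L1 L2 Lam M :: real
    and lam mu :: "nat \<Rightarrow> real"
    and \<alpha> \<beta> \<gamma> \<alpha>' \<beta>' \<gamma>' :: "nat \<Rightarrow> real"
    and k j :: "nat \<Rightarrow> nat"
    and u v x y :: "nat \<Rightarrow> 'a"
  assumes uniformly_convex: "uniformly_convex TYPE('a)"
    and opial: "opial_condition TYPE('a)"
    and K: "K \<noteq> {}" "closed K" "convex K"
    and N: "N \<ge> 1"
    and T_maps: "\<forall>i\<in>{1..N}. T i \<in> K \<rightarrow> K"
    and I_maps: "\<forall>i\<in>{1..N}. I i \<in> K \<rightarrow> K"
    and T_lipschitz: "\<forall>i\<in>{1..N}. uniformly_lipschitzian K (T i) L1"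
    and T_aqn: "\<forall>i\<in>{1..N}. asymptotically_quasi_nonexpansive_wrt K (I i) (T i) lam"
    and I_lipschitz: "\<forall>i\<in>{1..N}. uniformly_lipschitzian K (I i) L2"
    and I_aqn: "\<forall>i\<in>{1..N}. asymptotically_quasi_nonexpansive K (I i) mu"
    and F_def: "F = (\<Inter>i\<in>{1..N}. fixed_points K (T i) \<inter> fixed_points K (I i))"
    and F_nonempty: "F \<noteq> {}"
    and Lam_def: "Lam = (SUP n\<in>{1..}. lam n)"
    and M_def: "M = (SUP n\<in>{1..}. mu n)"
    and coeffs_range: "\<forall>n\<ge>1. {\<alpha> n, \<beta> n, \<gamma> n, \<alpha>' n, \<beta>' n, \<gamma>' n} \<subseteq> {0..1}"
    and cond_i: "\<forall>n\<ge>1. \<alpha> n + \<beta> n + \<gamma> n = 1 \<and> \<alpha>' n + \<beta>' n + \<gamma>' n = 1"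
    and cond_ii: "summable (\<lambda>n. (lam (Suc n) * mu (Suc n) - 1) * \<beta> (Suc n))"
    and cond_iii: "0 < (INF n\<in>{1..}. \<beta> n)"
      "(INF n\<in>{1..}. \<beta> n) \<le> (SUP n\<in>{1..}. \<beta> n)"
      "(SUP n\<in>{1..}. \<beta> n) < 1 / (Lam\<^sup>2 * M\<^sup>2)"
      "1 / (Lam\<^sup>2 * M\<^sup>2) < 1"
    and cond_iv: "0 < (INF n\<in>{1..}. \<beta>' n)"
      "(INF n\<in>{1..}. \<beta>' n) \<le> (SUP n\<in>{1..}. \<beta>' n)"
      "(SUP n\<in>{1..}. \<beta>' n) < 1"
    and cond_v: "summable (\<lambda>n. \<gamma> (Suc n))" "summable (\<lambda>n. \<gamma>' (Suc n))"
    and u: "u ` {1..} \<subseteq> K" "bounded (u ` {1..})"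
    and v: "v ` {1..} \<subseteq> K" "bounded (v ` {1..})"
    and kj: "\<forall>n\<ge>1. k n \<ge> 1 \<and> j n \<in> {1..N} \<and> n = (k n - 1) * N + j n"
    and x_in_K: "\<forall>n. x n \<in> K"
    and x_eq: "\<forall>n\<ge>1. x n = \<alpha> n *\<^sub>R x (n - 1) + \<beta> n *\<^sub>R (T (j n) ^^ k n) (y n) + \<gamma> n *\<^sub>R u n"
    and y_eq: "\<forall>n\<ge>1. y n = \<alpha>' n *\<^sub>R x n + \<beta>' n *\<^sub>R (I (j n) ^^ k n) (x n) + \<gamma>' n *\<^sub>R v n"
    and T_semi_closed: "\<forall>i\<in>{1..N}. semi_closed_at_zero K (\<lambda>z. id z - T i z)"
    and I_semi_closed: "\<forall>i\<in>{1..N}. semi_closed_at_zero K (\<lambda>z. id z - I i z)"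
  shows "\<exists>q\<in>F. weakly_converges x q"
proof -

  \<comment> \<open>Constants, indices and coefficients\<close>
  have one: "1 \<in> {1..N}" using N by simp
  have lam1: "1 \<le> lam n" and mu1: "1 \<le> mu n" if "n \<ge> 1" for n
    using T_aqn I_aqn one that
    unfolding asymptotically_quasi_nonexpansive_def asymptotically_quasi_nonexpansive_wrt_def by blast+
  have lam_lim: "lam \<longlonglongrightarrow> 1" and mu_lim: "mu \<longlonglongrightarrow> 1"
    using T_aqn I_aqn one
    unfolding asymptotically_quasi_nonexpansive_def asymptotically_quasi_nonexpansive_wrt_def by blast+
  \<comment> \<open>Boundedness, from convergence, makes the real suprema \<open>Lam\<close> and
    \<open>M\<close> actual upper bounds.\<close>
  have bdd: "bdd_above (f ` {1..})" if "f \<longlonglongrightarrow> 1" for f :: "nat \<Rightarrow> real"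
    using bounded_imp_bdd_above[OF convergent_imp_bounded[OF that]] by (rule bdd_above_mono) auto
  have lamL: "lam n \<le> Lam" and muM: "mu n \<le> M" if "n \<ge> 1" for n
    unfolding Lam_def M_def using cSUP_upper[OF _ bdd[OF lam_lim]] cSUP_upper[OF _ bdd[OF mu_lim]] that
    by (metis atLeast_iff)+
  define H where "H = Lam * M"
  have Lam1: "1 \<le> Lam" and M1: "1 \<le> M"
    using lam1[of 1] lamL[of 1] mu1[of 1] muM[of 1] by auto
  have H1: "1 \<le> H" unfolding H_def using Lam1 M1 by (metis mult_mono mult_1 zero_le_one order_trans)
  \<comment> \<open>The factor by which the iterate of \<open>T (j n)\<close> may enlarge distances
    to a common fixed point: \<open>lam\<close> for \<open>T\<close> relative to \<open>I\<close>,
    \<open>mu\<close> for \<open>I\<close>.\<close>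
  define g where "g n = lam (k n) * mu (k n)" for n
  have k1: "k n \<ge> 1" and jN: "j n \<in> {1..N}" if "n \<ge> 1" for n
    using kj that by blast+
  have g1: "1 \<le> g n" and mug: "mu (k n) \<le> g n" and gH: "g n \<le> H" if "n \<ge> 1" for n
  proof -
    note b = lam1[OF k1[OF that]] mu1[OF k1[OF that]] lamL[OF k1[OF that]] muM[OF k1[OF that]]
    show "1 \<le> g n" "mu (k n) \<le> g n" "g n \<le> H"
      using b mult_mono[of 1 "lam (k n)" 1 "mu (k n)"] mult_right_mono[of 1 "lam (k n)" "mu (k n)"]
        mult_mono[of "lam (k n)" Lam "mu (k n)" M]
      by (simp_all add: g_def H_def)
  qed
  define Bs where "Bs = (SUP n\<in>{1..}. \<beta> n)"
  define Bi where "Bi = (INF n\<in>{1..}. \<beta> n)"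
  define Bs' where "Bs' = (SUP n\<in>{1..}. \<beta>' n)"
  define Bi' where "Bi' = (INF n\<in>{1..}. \<beta>' n)"
  have coef: "0 \<le> \<alpha> n" "0 \<le> \<beta> n" "0 \<le> \<gamma> n" "0 \<le> \<alpha>' n" "0 \<le> \<beta>' n" "0 \<le> \<gamma>' n"
      "\<beta> n \<le> 1" "\<beta>' n \<le> 1"
    if "n \<ge> 1" for n
    using coeffs_range that by auto
  have sum1: "\<alpha> n + \<beta> n + \<gamma> n = 1" "\<alpha>' n + \<beta>' n + \<gamma>' n = 1" if "n \<ge> 1" for n
    using cond_i that by auto
  have \<beta>B: "Bi \<le> \<beta> n" "\<beta> n \<le> Bs" "Bi' \<le> \<beta>' n" "\<beta>' n \<le> Bs'" if "n \<ge> 1" for n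
    unfolding Bi_def Bs_def Bi'_def Bs'_def using that coef
    by (auto intro!: cINF_lower cSUP_upper bdd_aboveI2[of _ _ 1] bdd_belowI2[of _ 0])
  have Bi: "0 < Bi" "0 < Bi'" "Bs < 1" "Bs' < 1"
    using cond_iii cond_iv by (simp_all add: Bi_def Bs_def Bi'_def Bs'_def)
  have BsH: "Bs * H\<^sup>2 < 1"
    using cond_iii(3)[folded Bs_def] Lam1 M1 by (simp add: H_def power_mult_distrib pos_less_divide_eq)
  \<comment> \<open>The implicit scheme has \<open>norm (x n - p)\<close> on both sides;
    \<open>c0\<close> bounds from below the coefficient remaining on the left.\<close>
  define c0 where "c0 = 1 - Bs * H\<^sup>2"
  have c0: "0 < c0" using BsH by (simp add: c0_def)
  have k_eq: "k (Suc n) = Suc (n div N)" for n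
  proof -
    have "k (Suc n) \<ge> 1" "j (Suc n) \<in> {1..N}" "Suc n = (k (Suc n) - 1) * N + j (Suc n)"
      using kj by (metis le_add1 plus_1_eq_Suc)+
    from cyclic_index_eq(1)[OF N this] show ?thesis by simp
  qed
  have k_lim: "filterlim k at_top sequentially"
  proof (subst filterlim_sequentially_Suc[symmetric], unfold k_eq filterlim_at_top, rule allI)
    fix Z
    show "\<forall>\<^sub>F n in sequentially. Z \<le> Suc (n div N)"
      using eventually_ge_at_top[of "N * Z"]
    proof eventually_elim
      case (elim n)
      then have "N * Z div N \<le> n div N" by (rule div_le_mono)
      then show ?case using N by simp
    qed
  qed
  have lamk: "(\<lambda>n. lam (k n)) \<longlonglongrightarrow> 1" and muk: "(\<lambda>n. mu (k n)) \<longlonglongrightarrow> 1"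
    by (rule filterlim_compose[OF lam_lim k_lim], rule filterlim_compose[OF mu_lim k_lim])
  then have g_lim: "g \<longlonglongrightarrow> 1"
    unfolding g_def using tendsto_mult[OF lamk muk] by simp
  \<comment> \<open>The lower bound \<open>Bi\<close> removes the weight \<beta> from
    \<open>cond_ii\<close>; repeating each term \<open>N\<close> times passes to the index
    \<open>k n\<close>.\<close>
  have g_sum: "summable (\<lambda>n. g (Suc n) - 1)"
  proof -
    let ?s = "\<lambda>n. lam (Suc n) * mu (Suc n) - 1"
    have s0: "0 \<le> ?s n" for n
      using mult_mono[of 1 "lam (Suc n)" 1 "mu (Suc n)"] lam1[of "Suc n"] mu1[of "Suc n"] by simp
    have "summable (\<lambda>n. inverse Bi * (?s n * \<beta> (Suc n)))"
      by (rule summable_mult[OF cond_ii])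
    then have "summable ?s"
    proof (rule summable_comparison_test'[where N = 0])
      fix n
      have "?s n * Bi \<le> ?s n * \<beta> (Suc n)" by (intro mult_left_mono \<beta>B s0) simp
      then show "norm (?s n) \<le> inverse Bi * (?s n * \<beta> (Suc n))"
        using Bi(1) s0[of n] by (simp add: field_simps)
    qed
    then have "summable (\<lambda>n. ?s (n div N))"
      by (intro summable_comp_div s0 N)
    then show ?thesis by (simp add: g_def k_eq)
  qed
  have \<gamma>0: "\<gamma> \<longlonglongrightarrow> 0" "\<gamma>' \<longlonglongrightarrow> 0"
    using cond_v[THEN summable_LIMSEQ_zero] by (simp_all only: filterlim_sequentially_Suc)
  have Tm: "T (j n) \<in> K \<rightarrow> K" "I (j n) \<in> K \<rightarrow> K" if "n \<ge> 1" for n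
    using T_maps I_maps jN[OF that] by blast+
  have Ix: "(I (j n) ^^ k n) (x n) \<in> K" if "n \<ge> 1" for n
    using funpow_mem[OF Tm(2)[OF that]] x_in_K by blast
  have uK: "u n \<in> K" "v n \<in> K" if "n \<ge> 1" for n
    using u(1) v(1) that by auto
  have yK: "y n \<in> K" if "n \<ge> 1" for n
    using y_eq that convex_combination3_mem[OF K(3) x_in_K[rule_format] Ix[OF that] uK(2)[OF that] coef(4-6)[OF that] sum1(2)[OF that]]
    by metis
  have Ty: "(T (j n) ^^ k n) (y n) \<in> K" if "n \<ge> 1" for n
    using funpow_mem[OF Tm(1)[OF that]] yK[OF that] by blast

  \<comment> \<open>Distances to a common fixed point\<close>
  have Fp: "p \<in> fixed_points K (T i)" "p \<in> fixed_points K (I i)" "p \<in> K" if "p \<in> F" "i \<in> {1..N}" for p i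
    using that by (auto simp: F_def fixed_points_def)
  have Ib: "norm ((I (j n) ^^ k n) z - p) \<le> mu (k n) * norm (z - p)"
    if "p \<in> F" "n \<ge> 1" "z \<in> K" for p n z
    using I_aqn jN[OF that(2)] k1[OF that(2)] Fp[OF that(1) jN[OF that(2)]] that(3)
    unfolding asymptotically_quasi_nonexpansive_def by blast
  have Tb: "norm ((T (j n) ^^ k n) z - p) \<le> g n * norm (z - p)"
    if "p \<in> F" "n \<ge> 1" "z \<in> K" for p n z
  proof -
    have "norm ((T (j n) ^^ k n) z - p) \<le> lam (k n) * norm ((I (j n) ^^ k n) z - p)"
      using T_aqn jN[OF that(2)] k1[OF that(2)] Fp[OF that(1) jN[OF that(2)]] that(3)
      unfolding asymptotically_quasi_nonexpansive_wrt_def by blast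
    also have "\<dots> \<le> lam (k n) * (mu (k n) * norm (z - p))"
      using lam1[OF k1[OF that(2)]] by (intro mult_left_mono Ib that) simp
    finally show ?thesis by (simp add: g_def mult.assoc)
  qed
  obtain Cu where Cu: "\<And>n. n \<ge> 1 \<Longrightarrow> norm (u n) \<le> Cu"
    using u(2) unfolding bounded_iff by auto
  obtain Cv where Cv: "\<And>n. n \<ge> 1 \<Longrightarrow> norm (v n) \<le> Cv"
    using v(2) unfolding bounded_iff by auto
  have uvb: "norm (u n - p) \<le> max Cu Cv + norm p" "norm (v n - p) \<le> max Cu Cv + norm p"
    if "n \<ge> 1" for n p
    using Cu[OF that] Cv[OF that] norm_triangle_ineq4[of "u n" p] norm_triangle_ineq4[of "v n" p] by linarith+
  have yb: "norm (y n - p) \<le> mu (k n) * norm (x n - p) + \<gamma>' n * (max Cu Cv + norm p)"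
    if p: "p \<in> F" and n: "n \<ge> 1" for p n
  proof -
    have "norm (y n - p) \<le> \<alpha>' n * norm (x n - p) + \<beta>' n * norm ((I (j n) ^^ k n) (x n) - p) + \<gamma>' n * norm (v n - p)"
      using norm_combination3_diff[OF coef(4-6)[OF n] sum1(2)[OF n]] y_eq n by metis
    also have "\<dots> \<le> \<alpha>' n * (mu (k n) * norm (x n - p)) + \<beta>' n * (mu (k n) * norm (x n - p)) + \<gamma>' n * (max Cu Cv + norm p)"
      using mult_right_mono[OF mu1[OF k1[OF n]], of "norm (x n - p)"]
      by (intro add_mono mult_left_mono coef Ib p n uvb) (use x_in_K in auto)
    also have "\<dots> = (\<alpha>' n + \<beta>' n) * (mu (k n) * norm (x n - p)) + \<gamma>' n * (max Cu Cv + norm p)"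
      by (simp add: algebra_simps)
    also have "\<dots> \<le> 1 * (mu (k n) * norm (x n - p)) + \<gamma>' n * (max Cu Cv + norm p)"
      using sum1(2)[OF n] coef(6)[OF n] mu1[OF k1[OF n]] by (intro add_right_mono mult_right_mono) auto
    finally show ?thesis by simp
  qed
  have lim_ex: "convergent (\<lambda>n. norm (x n - p))" if p: "p \<in> F" for p
  proof -
    let ?C = "max Cu Cv + norm p"
    have C0: "0 \<le> ?C" using uvb(1)[of 1 p] norm_ge_zero[of "u 1 - p"] by linarith
    \<comment> \<open>The factor \<open>H + 1\<close> comes from
      \<open>(g n)^2 - 1 \<le> (H + 1) * (g n - 1)\<close>, the factor \<open>H\<close> in
      \<open>e\<close> from passing the error of \<open>y\<close> through an iterate of
      \<open>T\<close>, and \<open>c0\<close> from dividing by the coefficient on the left.\<close>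
    define b where "b n = ((H + 1) / c0) * (g (Suc n) - 1)" for n
    define e where "e n = (?C * H / c0) * \<gamma>' (Suc n) + (?C / c0) * \<gamma> (Suc n)" for n
    show ?thesis
    proof (rule convergent_of_recursive_bound)
      show "summable b" "summable e"
        unfolding b_def e_def by (intro summable_add summable_mult g_sum cond_v)+
      show "0 \<le> b n" "0 \<le> e n" for n
        unfolding b_def e_def using g1[of "Suc n"] H1 c0 C0 coef[of "Suc n"] by simp_all
      fix n
      let ?n = "Suc n"
      have n: "?n \<ge> 1" by simp
      define X where "X = norm (x ?n - p)"
      define X' where "X' = norm (x n - p)"
      have X0: "0 \<le> X" "0 \<le> X'" by (simp_all add: X_def X'_def)
      have "norm ((T (j ?n) ^^ k ?n) (y ?n) - p) \<le> g ?n * norm (y ?n - p)"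
        by (rule Tb[OF p n yK[OF n]])
      also have "\<dots> \<le> g ?n * (g ?n * X + \<gamma>' ?n * ?C)"
        using yb[OF p n] mult_right_mono[OF mug[OF n] X0(1)] g1[OF n]
        by (intro mult_left_mono) (auto simp: X_def)
      also have "\<dots> \<le> (g ?n)\<^sup>2 * X + H * (\<gamma>' ?n * ?C)"
        using mult_right_mono[OF gH[OF n] mult_nonneg_nonneg[OF coef(6)[OF n] C0]]
        by (simp add: distrib_left power2_eq_square mult.assoc)
      finally have t: "norm ((T (j ?n) ^^ k ?n) (y ?n) - p) \<le> (g ?n)\<^sup>2 * X + H * (\<gamma>' ?n * ?C)" .
      have "x ?n = \<alpha> ?n *\<^sub>R x n + \<beta> ?n *\<^sub>R (T (j ?n) ^^ k ?n) (y ?n) + \<gamma> ?n *\<^sub>R u ?n"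
        using x_eq n by (metis diff_Suc_1)
      then have "X \<le> \<alpha> ?n * X' + \<beta> ?n * norm ((T (j ?n) ^^ k ?n) (y ?n) - p) + \<gamma> ?n * norm (u ?n - p)"
        using norm_combination3_diff[OF coef(1-3)[OF n] sum1(1)[OF n]] unfolding X_def X'_def by metis
      also have "\<dots> \<le> (1 - \<beta> ?n) * X' + (\<beta> ?n * ((g ?n)\<^sup>2 * X) + H * (\<gamma>' ?n * ?C)) + \<gamma> ?n * ?C"
      proof (intro add_mono mult_left_mono mult_right_mono uvb n coef X0)
        show "\<alpha> ?n \<le> 1 - \<beta> ?n" using sum1(1)[OF n] coef(3)[OF n] by simp
        have "\<beta> ?n * norm ((T (j ?n) ^^ k ?n) (y ?n) - p) \<le> \<beta> ?n * ((g ?n)\<^sup>2 * X) + \<beta> ?n * (H * (\<gamma>' ?n * ?C))"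
          using mult_left_mono[OF t coef(2)[OF n]] by (simp add: algebra_simps)
        also have "\<beta> ?n * (H * (\<gamma>' ?n * ?C)) \<le> 1 * (H * (\<gamma>' ?n * ?C))"
          using coef(6,7)[OF n] H1 C0 by (intro mult_right_mono) auto
        finally show "\<beta> ?n * norm ((T (j ?n) ^^ k ?n) (y ?n) - p) \<le> \<beta> ?n * ((g ?n)\<^sup>2 * X) + H * (\<gamma>' ?n * ?C)"
          by simp
      qed
      finally have main: "(1 - \<beta> ?n * (g ?n)\<^sup>2) * X \<le> (1 - \<beta> ?n) * X' + (H * (\<gamma>' ?n * ?C) + \<gamma> ?n * ?C)"
        by (simp add: algebra_simps)
      define w where "w = 1 - \<beta> ?n * (g ?n)\<^sup>2"
      have "\<beta> ?n * (g ?n)\<^sup>2 \<le> Bs * H\<^sup>2"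
        using \<beta>B(2)[OF n] coef(2)[OF n] gH[OF n] g1[OF n] by (intro mult_mono power_mono) auto
      then have w: "c0 \<le> w" by (simp add: w_def c0_def)
      then have w0: "0 < w" using c0 by simp
      have "(g ?n)\<^sup>2 - 1 = (g ?n + 1) * (g ?n - 1)" by (simp add: power2_eq_square algebra_simps)
      also have "\<dots> \<le> (H + 1) * (g ?n - 1)"
        using gH[OF n] g1[OF n] by (intro mult_right_mono) auto
      finally have gg: "(g ?n)\<^sup>2 - 1 \<le> (H + 1) * (g ?n - 1)" .
      have g2: "0 \<le> (g ?n)\<^sup>2 - 1" using g1[OF n] by simp
      \<comment> \<open>The coefficient of \<open>X'\<close> exceeds that of \<open>X\<close> by a
        term of order \<open>g ?n - 1\<close>, so their quotient is at most \<open>1\<close> plus a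
        summable amount.\<close>
      have "1 - \<beta> ?n = w + \<beta> ?n * ((g ?n)\<^sup>2 - 1)" by (simp add: w_def algebra_simps)
      also have "\<dots> \<le> w + 1 * ((H + 1) * (g ?n - 1))"
        using gg g2 coef(2,7)[OF n] by (intro add_left_mono mult_mono) auto
      also have "\<dots> = w + c0 * b n" using c0 by (simp add: b_def)
      also have "\<dots> \<le> w + w * b n"
        using w g1[OF n] H1 c0 by (intro add_left_mono mult_right_mono) (simp_all add: b_def)
      finally have bb: "1 - \<beta> ?n \<le> w * (1 + b n)" by (simp add: algebra_simps)
      have "H * (\<gamma>' ?n * ?C) + \<gamma> ?n * ?C = c0 * e n"
        using c0 by (simp add: e_def field_simps)
      also have "\<dots> \<le> w * e n"
        using w c0 C0 H1 coef[OF n] by (intro mult_right_mono) (simp_all add: e_def)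
      finally have "w * X \<le> w * (1 + b n) * X' + w * e n"
        using main mult_right_mono[OF bb X0(2)] unfolding w_def[symmetric] by linarith
      then have "w * X \<le> w * ((1 + b n) * X' + e n)" by (simp add: algebra_simps)
      then show "norm (x ?n - p) \<le> (1 + b n) * norm (x n - p) + e n"
        using w0 by (simp add: X_def X'_def)
    qed simp
  qed

  \<comment> \<open>Asymptotic regularity\<close>
  obtain p where p: "p \<in> F" using F_nonempty by blast
  obtain d where d: "(\<lambda>n. norm (x n - p)) \<longlonglongrightarrow> d"
    using lim_ex[OF p] unfolding convergent_def by blast
  have xbd: "bounded (range x)"
  proof -
    obtain R where "\<And>n. norm (x n - p) \<le> R"
      using convergent_imp_bounded[OF d] by (auto simp: bounded_iff)
    then have "norm (x n) \<le> R + norm p" for n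
      using norm_triangle_ineq2[of "x n" p] by (metis add.commute diff_le_eq order_trans)
    then show ?thesis by (auto simp: bounded_iff)
  qed
  then obtain R where R: "\<And>n. norm (x n) \<le> R" by (auto simp: bounded_iff)
  \<comment> \<open>At \<open>n = 0\<close> the truncated \<open>n - 1\<close> gives
    \<open>x 0\<close> again, which does not affect the limit.\<close>
  have d': "(\<lambda>n. norm (x (n - 1) - p)) \<longlonglongrightarrow> d"
    by (subst filterlim_sequentially_Suc[symmetric]) (simp add: d)
  let ?C = "max Cu Cv + norm p"
  have y_up: "(\<lambda>n. mu (k n) * norm (x n - p) + \<gamma>' n * ?C) \<longlonglongrightarrow> d"
    using tendsto_add[OF tendsto_mult[OF muk d] tendsto_mult_right[OF \<gamma>0(2), of ?C]] by simp
  have ev: "\<forall>\<^sub>F n in sequentially. (1::nat) \<le> n" by (rule eventually_ge_at_top)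
  \<comment> \<open>Both \<open>x (n - 1)\<close> and the iterate of \<open>y n\<close> are
    asymptotically within \<open>d\<close> of \<open>p\<close>, while their perturbed combination
    \<open>x n\<close> attains \<open>d\<close>. The constant \<open>min Bi (1 - Bs)\<close> keeps
    \<beta> away from \<open>0\<close> and \<open>1\<close>.\<close>
  have xT: "(\<lambda>n. x (n - 1) - (T (j n) ^^ k n) (y n)) \<longlonglongrightarrow> 0"
  proof (rule uniformly_convex_tendsto_diff_error[OF uniformly_convex _ _ _ \<gamma>0(1) _ d' _ _ d,
        where c = "min Bi (1 - Bs)" and t = \<beta> and s = \<alpha> and e = u and D = "Cu + R"
          and B = "\<lambda>n. g n * (mu (k n) * norm (x n - p) + \<gamma>' n * ?C)"])
    show "0 < min Bi (1 - Bs)" using Bi by simp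
    show "\<forall>\<^sub>F n in sequentially. min Bi (1 - Bs) \<le> \<beta> n \<and> \<beta> n \<le> 1 - min Bi (1 - Bs)"
      using ev by eventually_elim (use \<beta>B in \<open>fastforce simp: min_def\<close>)
    show "\<forall>\<^sub>F n in sequentially. x n = \<alpha> n *\<^sub>R x (n - 1) + \<beta> n *\<^sub>R (T (j n) ^^ k n) (y n) + \<gamma> n *\<^sub>R u n
        \<and> \<alpha> n + \<beta> n + \<gamma> n = 1"
      using ev by eventually_elim (use x_eq sum1 in blast)
    show "\<forall>\<^sub>F n in sequentially. norm (u n - x (n - 1)) \<le> Cu + R"
      using ev by eventually_elim (meson Cu R norm_triangle_le_diff add_mono)
    show "\<forall>\<^sub>F n in sequentially. norm ((T (j n) ^^ k n) (y n) - p) \<le> g n * (mu (k n) * norm (x n - p) + \<gamma>' n * ?C)"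
      using ev
    proof eventually_elim
      case (elim n)
      have "norm ((T (j n) ^^ k n) (y n) - p) \<le> g n * norm (y n - p)"
        by (rule Tb[OF p elim yK[OF elim]])
      also have "\<dots> \<le> g n * (mu (k n) * norm (x n - p) + \<gamma>' n * ?C)"
        using g1[OF elim] by (intro mult_left_mono yb p elim) simp
      finally show ?case .
    qed
    show "(\<lambda>n. g n * (mu (k n) * norm (x n - p) + \<gamma>' n * ?C)) \<longlonglongrightarrow> d"
      using tendsto_mult[OF g_lim y_up] by simp
  qed
  have step': "(\<lambda>n. x n - x (n - 1)) \<longlonglongrightarrow> 0"
  proof (rule Lim_null_comparison)
    show "\<forall>\<^sub>F n in sequentially. norm (x n - x (n - 1))
        \<le> norm (x (n - 1) - (T (j n) ^^ k n) (y n)) + \<gamma> n * (Cu + R)"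
      using ev
    proof eventually_elim
      case (elim n)
      let ?t = "(T (j n) ^^ k n) (y n)"
      have "norm (x n - x (n - 1)) \<le> \<alpha> n * norm (x (n - 1) - x (n - 1)) + \<beta> n * norm (?t - x (n - 1)) + \<gamma> n * norm (u n - x (n - 1))"
        using norm_combination3_diff[OF coef(1-3)[OF elim] sum1(1)[OF elim]] x_eq elim by metis
      also have "\<dots> \<le> 0 + 1 * norm (x (n - 1) - ?t) + \<gamma> n * (Cu + R)"
        using norm_triangle_ineq4[of "u n" "x (n - 1)"] Cu[OF elim] R[of "n - 1"] coef[OF elim]
        by (intro add_mono mult_left_mono mult_mono) (auto simp: norm_minus_commute)
      finally show ?case by simp
    qed
    show "(\<lambda>n. norm (x (n - 1) - (T (j n) ^^ k n) (y n)) + \<gamma> n * (Cu + R)) \<longlonglongrightarrow> 0"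
      using tendsto_add[OF tendsto_norm_zero[OF xT] tendsto_mult_right[OF \<gamma>0(1), of "Cu + R"]] by simp
  qed
  then have step: "(\<lambda>n. x (Suc n) - x n) \<longlonglongrightarrow> 0"
    by (subst (asm) filterlim_sequentially_Suc[symmetric]) simp
  have xTy: "(\<lambda>n. x n - (T (j n) ^^ k n) (y n)) \<longlonglongrightarrow> 0"
    using tendsto_add[OF step' xT] by simp
  \<comment> \<open>The lower bound is read backwards from the iterate of \<open>y n\<close>: its
    distance to \<open>p\<close> tends to \<open>d\<close> by \<open>xTy\<close> and is at most
    \<open>g n * norm (y n - p)\<close>.\<close>
  have y_lim: "(\<lambda>n. norm (y n - p)) \<longlonglongrightarrow> d"
  proof (rule tendsto_sandwich)
    show "\<forall>\<^sub>F n in sequentially.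
        (norm (x n - p) - norm (x n - (T (j n) ^^ k n) (y n))) / g n \<le> norm (y n - p)"
      using ev
    proof eventually_elim
      case (elim n)
      have "norm (x n - p) - norm (x n - (T (j n) ^^ k n) (y n)) \<le> norm ((T (j n) ^^ k n) (y n) - p)"
        using norm_triangle_ineq[of "x n - (T (j n) ^^ k n) (y n)" "(T (j n) ^^ k n) (y n) - p"] by simp
      also have "\<dots> \<le> g n * norm (y n - p)" by (rule Tb[OF p elim yK[OF elim]])
      finally show ?case using g1[OF elim] by (simp add: pos_divide_le_eq mult.commute)
    qed
    show "(\<lambda>n. (norm (x n - p) - norm (x n - (T (j n) ^^ k n) (y n))) / g n) \<longlonglongrightarrow> d"
      using tendsto_divide[OF tendsto_diff[OF d tendsto_norm_zero[OF xTy]] g_lim] by simp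
    show "\<forall>\<^sub>F n in sequentially. norm (y n - p) \<le> mu (k n) * norm (x n - p) + \<gamma>' n * ?C"
      using ev by eventually_elim (rule yb[OF p])
    show "(\<lambda>n. mu (k n) * norm (x n - p) + \<gamma>' n * ?C) \<longlonglongrightarrow> d" by (rule y_up)
  qed
  \<comment> \<open>The same argument one level down, with \<open>y n\<close> as the combination and
    \<open>y_lim\<close> supplying the limit \<open>d\<close>.\<close>
  have xI: "(\<lambda>n. x n - (I (j n) ^^ k n) (x n)) \<longlonglongrightarrow> 0"
  proof (rule uniformly_convex_tendsto_diff_error[OF uniformly_convex _ _ _ \<gamma>0(2) _ d _ _ y_lim,
        where c = "min Bi' (1 - Bs')" and t = \<beta>' and s = \<alpha>' and e = v and D = "Cv + R"
          and B = "\<lambda>n. mu (k n) * norm (x n - p)"])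
    show "0 < min Bi' (1 - Bs')" using Bi by simp
    show "\<forall>\<^sub>F n in sequentially. min Bi' (1 - Bs') \<le> \<beta>' n \<and> \<beta>' n \<le> 1 - min Bi' (1 - Bs')"
      using ev by eventually_elim (use \<beta>B in \<open>fastforce simp: min_def\<close>)
    show "\<forall>\<^sub>F n in sequentially. y n = \<alpha>' n *\<^sub>R x n + \<beta>' n *\<^sub>R (I (j n) ^^ k n) (x n) + \<gamma>' n *\<^sub>R v n
        \<and> \<alpha>' n + \<beta>' n + \<gamma>' n = 1"
      using ev by eventually_elim (use y_eq sum1 in blast)
    show "\<forall>\<^sub>F n in sequentially. norm (v n - x n) \<le> Cv + R"
      using ev by eventually_elim (meson Cv R norm_triangle_le_diff add_mono)
    show "\<forall>\<^sub>F n in sequentially. norm ((I (j n) ^^ k n) (x n) - p) \<le> mu (k n) * norm (x n - p)"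
      using ev by eventually_elim (use Ib[OF p] x_in_K in blast)
    show "(\<lambda>n. mu (k n) * norm (x n - p)) \<longlonglongrightarrow> d"
      using tendsto_mult[OF muk d] by simp
  qed
  \<comment> \<open>\<open>xI\<close> and the vanishing \<gamma>' make \<open>y n - x n\<close> tend
    to \<open>0\<close>; the Lipschitz constant is the same for all exponents, so the iterate can be
    taken at \<open>x n\<close> instead.\<close>
  have xTx: "(\<lambda>n. x n - (T (j n) ^^ k n) (x n)) \<longlonglongrightarrow> 0"
  proof (rule Lim_null_comparison)
    have L1: "0 < L1" using T_lipschitz one unfolding uniformly_lipschitzian_def by blast
    show "\<forall>\<^sub>F n in sequentially. norm (x n - (T (j n) ^^ k n) (x n))
        \<le> norm (x n - (T (j n) ^^ k n) (y n)) + L1 * (norm (x n - (I (j n) ^^ k n) (x n)) + \<gamma>' n * (Cv + R))"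
      using ev
    proof eventually_elim
      case (elim n)
      let ?t = "(T (j n) ^^ k n) (y n)"
      have "norm (y n - x n) \<le> \<alpha>' n * norm (x n - x n) + \<beta>' n * norm ((I (j n) ^^ k n) (x n) - x n) + \<gamma>' n * norm (v n - x n)"
        using norm_combination3_diff[OF coef(4-6)[OF elim] sum1(2)[OF elim]] y_eq elim by metis
      also have "\<dots> \<le> 0 + 1 * norm (x n - (I (j n) ^^ k n) (x n)) + \<gamma>' n * (Cv + R)"
        using norm_triangle_ineq4[of "v n" "x n"] Cv[OF elim] R[of n] coef[OF elim]
        by (intro add_mono mult_left_mono mult_mono) (auto simp: norm_minus_commute)
      finally have yx: "norm (y n - x n) \<le> norm (x n - (I (j n) ^^ k n) (x n)) + \<gamma>' n * (Cv + R)" by simp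
      have "norm (?t - (T (j n) ^^ k n) (x n)) \<le> L1 * norm (y n - x n)"
        using T_lipschitz jN[OF elim] k1[OF elim] yK[OF elim] x_in_K
        unfolding uniformly_lipschitzian_def by blast
      also have "\<dots> \<le> L1 * (norm (x n - (I (j n) ^^ k n) (x n)) + \<gamma>' n * (Cv + R))"
        using yx L1 by simp
      finally show ?case
        using norm_triangle_ineq[of "x n - ?t" "?t - (T (j n) ^^ k n) (x n)"] by simp
    qed
    have "(\<lambda>n. norm (x n - (T (j n) ^^ k n) (y n)) + L1 * (norm (x n - (I (j n) ^^ k n) (x n)) + \<gamma>' n * (Cv + R)))
        \<longlonglongrightarrow> 0 + L1 * (0 + 0 * (Cv + R))"
      by (intro tendsto_intros tendsto_norm_zero xTy xI \<gamma>0)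
    then show "(\<lambda>n. norm (x n - (T (j n) ^^ k n) (y n)) + L1 * (norm (x n - (I (j n) ^^ k n) (x n)) + \<gamma>' n * (Cv + R)))
        \<longlonglongrightarrow> 0" by simp
  qed

  \<comment> \<open>Identification of the weak limits\<close>
  have T0: "(\<lambda>n. x n - T i (x n)) \<longlonglongrightarrow> 0" and I0: "(\<lambda>n. x n - I i (x n)) \<longlonglongrightarrow> 0"
    if "i \<in> {1..N}" for i
    by (rule cyclic_iterates_asymptotically_fixed[OF N T_maps T_lipschitz kj x_in_K step xTx that],
        rule cyclic_iterates_asymptotically_fixed[OF N I_maps I_lipschitz kj x_in_K step xI that])
  \<comment> \<open>Used twice: for all indices, to find \<open>q\<close>, and for the indices at
    which weak convergence to \<open>q\<close> would fail.\<close>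
  have sub: "\<exists>r l. strict_mono r \<and> range r \<subseteq> A \<and> l \<in> F \<and> weakly_converges (x \<circ> r) l" if "infinite A" for A
  proof -
    have "range x \<subseteq> K" using x_in_K by blast
    from bounded_weakly_convergent_subsequence[OF uniformly_convex that xbd K(2,3) this]
    obtain r l where r: "strict_mono r" "range r \<subseteq> A" "l \<in> K" "weakly_converges (x \<circ> r) l" .
    have b: "bounded (range (x \<circ> r))" "range (x \<circ> r) \<subseteq> K"
      using bounded_subset[OF xbd, of "range (x \<circ> r)"] x_in_K by auto
    have "T i l = l \<and> I i l = l" if i: "i \<in> {1..N}" for i
    proof -
      have "(\<lambda>n. id ((x \<circ> r) n) - T i ((x \<circ> r) n)) \<longlonglongrightarrow> 0" "(\<lambda>n. id ((x \<circ> r) n) - I i ((x \<circ> r) n)) \<longlonglongrightarrow> 0"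
        using LIMSEQ_subseq_LIMSEQ[OF T0[OF i] r(1)] LIMSEQ_subseq_LIMSEQ[OF I0[OF i] r(1)]
        by (simp_all add: o_def)
      then have "id l - T i l = 0" "id l - I i l = 0"
        using T_semi_closed I_semi_closed i b r(3,4) unfolding semi_closed_at_zero_def by blast+
      then show ?thesis by simp
    qed
    then have "l \<in> F" using r(3) by (auto simp: F_def fixed_points_def)
    with r show ?thesis by blast
  qed
  obtain r q where r: "strict_mono r" "q \<in> F" "weakly_converges (x \<circ> r) q"
    using sub[of UNIV] by auto
  \<comment> \<open>For \<open>z \<in> F\<close> all distances \<open>norm (x n - z)\<close>
    converge, so the liminf along a subsequence is the full limit, and Opial's inequality compares
    numbers independent of the subsequence.\<close>
  have opial_less: "lim (\<lambda>n. norm (x n - q)) < lim (\<lambda>n. norm (x n - q'))"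
    if "strict_mono r" "weakly_converges (x \<circ> r) q" "q \<in> F" "q' \<in> F" "q' \<noteq> q" for r q q'
  proof -
    have "liminf (\<lambda>n. ereal (norm ((x \<circ> r) n - z))) = ereal (lim (\<lambda>n. norm (x n - z)))" if "z \<in> F" for z
    proof -
      have "(\<lambda>n. norm (x n - z)) \<longlonglongrightarrow> lim (\<lambda>n. norm (x n - z))"
        using lim_ex[OF that] by (simp add: convergent_LIMSEQ_iff)
      then have "(\<lambda>n. ereal (norm ((x \<circ> r) n - z))) \<longlonglongrightarrow> ereal (lim (\<lambda>n. norm (x n - z)))"
        using LIMSEQ_subseq_LIMSEQ[OF _ \<open>strict_mono r\<close>] by (fastforce simp: o_def)
      then show ?thesis by (intro lim_imp_Liminf) simp_all
    qed
    then show ?thesis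
      using opial that unfolding opial_condition_def by (metis ereal_less_eq(3) linorder_not_le)
  qed
  have "weakly_converges x q"
    unfolding weakly_converges_def
  proof (intro allI impI, rule ccontr)
    fix f :: "'a \<Rightarrow> real" assume f: "bounded_linear f" and "\<not> (\<lambda>n. f (x n)) \<longlonglongrightarrow> f q"
    then obtain \<epsilon> where \<epsilon>: "0 < \<epsilon>" "\<not> (\<forall>\<^sub>F n in sequentially. dist (f (x n)) (f q) < \<epsilon>)"
      unfolding tendsto_iff by blast
    then have "infinite {n. \<not> dist (f (x n)) (f q) < \<epsilon>}"
      by (simp add: cofinite_eq_sequentially[symmetric] eventually_cofinite)
    \<comment> \<open>The new weak limit keeps the gap \<epsilon> under \<open>f\<close>, hence
      differs from \<open>q\<close>.\<close>
    from sub[OF this] obtain r' q' where r': "strict_mono r'"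
      "range r' \<subseteq> {n. \<not> dist (f (x n)) (f q) < \<epsilon>}" "q' \<in> F" "weakly_converges (x \<circ> r') q'"
      by blast
    have "(\<lambda>n. f ((x \<circ> r') n)) \<longlonglongrightarrow> f q'"
      using r'(4) f by (simp add: weakly_converges_def)
    then have "(\<lambda>n. dist (f ((x \<circ> r') n)) (f q)) \<longlonglongrightarrow> dist (f q') (f q)"
      by (intro tendsto_dist tendsto_const)
    moreover have "\<epsilon> \<le> dist (f ((x \<circ> r') n)) (f q)" for n
      using r'(2) by (auto simp: image_subset_iff not_less)
    ultimately have "\<epsilon> \<le> dist (f q') (f q)"
      by (intro LIMSEQ_le_const) auto
    with \<epsilon>(1) have "q' \<noteq> q" by auto
    \<comment> \<open>Exchanging the two weak limits gives opposite strict inequalities.\<close>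
    with opial_less[OF r(1,3,2) r'(3)] opial_less[OF r'(1,4,3) r(2)] show False by auto
  qed
  with r(2) show ?thesis by blast
qed

end
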